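(* Let $q$ be a prime power, $I=(n_1,\dots,n_l)$ a composition of $n$, and $\mathcal{P}=\mathbb{F}_q[x_1,\dots,x_n]$. Then $$\Psi_n=\{x_1^{i_1}\cdots x_n^{i_n}\mid 0\leq i_k<q^{\tau(k)}\text{ for all }k\}$$ is a basis for $\mathcal{P}$ as a module over $\mathcal{P}^{U_I}$. Namely, the monomial $f_I=\prod_{i=1}^{n}x_i^{q^{\tau(i)}-1}$ generates a block basis for $\mathcal{P}_{U_I}$.
   Context: Let $m_0=0$ and $m_k=\sum_{i=1}^k n_i$ for $1\le k\le l$ (all $n_i\geq 1$, $m_l=n$). For $1\le s\le n$, $\tau(s)=m_j$ if $m_j<s\le m_{j+1}$. $U_I\subseteq\operatorname{GL}_n(q)$ is the group of all block upper triangular matrices with diagonal blocks the identity matrices $I_{n_1},\dots,I_{n_l}$ (entries above the diagonal blocks arbitrary in $\mathbb{F}_q$). $\operatorname{GL}_n(q)$ acts on $V=\langle x_1,\dots,x_n\rangle_{\mathbb{F}_q}=\mathbb{F}_q^n$ naturally, i.e. $g\cdot x_k=\sum_i g_{ik}x_i$, and on $\mathcal{P}=S^\bullet(V)$ by algebra automorphisms. For a subgroup $G\le \operatorname{GL}_n(q)$, $\mathcal{P}^G$ is the ring of invariants and $\mathcal{P}_G=\mathcal{P}/\mathcal{I}$ with $\mathcal{I}$ the ideal generated by homogeneous elements of $\mathcal{P}^G$ of positive degree. A monomial $f$ generates a block basis for $\mathcal{P}_G$ if the set of all its monomial factors (monic monomial divisors) projects to an $\mathbb{F}_q$-basis of $\mathcal{P}/\mathcal{I}$.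 *)

theory Defs
  imports
    "HOL-Library.Poly_Mapping"
    "HOL-Library.Cardinality"
    "HOL-Algebra.Divisibility"
    "HOL-Algebra.QuotRing"
    "Jordan_Normal_Form.VS_Connect"
begin

section \<open>Polynomials in finitely many variables\<close>

text \<open>
  Variables are numbered from 0: the variable \<open>x\<^sub>k\<close> of the usual notation \<open>x\<^sub>1, \<dots>, x\<^sub>n\<close>
  is \<open>Var (k - 1)\<close>.  A polynomial is a finitely supported map from exponent vectors
  to coefficients.
\<close>

type_synonym 'a mpoly = "(nat \<Rightarrow>\<^sub>0 nat) \<Rightarrow>\<^sub>0 'a"

definition Var :: "nat \<Rightarrow> 'a::comm_ring_1 mpoly" where
  "Var k = Poly_Mapping.single (Poly_Mapping.single k 1) 1"

definition Const :: "'a::comm_ring_1 \<Rightarrow> 'a mpoly" where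
  "Const c = Poly_Mapping.single 0 c"

definition poly_ring :: "nat \<Rightarrow> 'a::comm_ring_1 mpoly ring" where
  "poly_ring n = \<lparr>
     carrier = {p. \<forall>m\<in>Poly_Mapping.keys p. Poly_Mapping.keys m \<subseteq> {..<n}},
     monoid.mult = (*), one = 1, zero = 0, add = (+)\<rparr>"

definition monomial :: "nat \<Rightarrow> (nat \<Rightarrow> nat) \<Rightarrow> 'a::comm_ring_1 mpoly" where
  "monomial n e = (\<Prod>k<n. Var k ^ e k)"

definition homogeneous :: "nat \<Rightarrow> 'a::comm_ring_1 mpoly \<Rightarrow> bool" where
  "homogeneous d p \<longleftrightarrow>
     (\<forall>m\<in>Poly_Mapping.keys p. (\<Sum>k\<in>Poly_Mapping.keys m. Poly_Mapping.lookup m k) = d)"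


section \<open>The action of the general linear group\<close>

definition subst :: "(nat \<Rightarrow> 'a::comm_ring_1 mpoly) \<Rightarrow> 'a mpoly \<Rightarrow> 'a mpoly" where
  "subst f p = (\<Sum>m\<in>Poly_Mapping.keys p. Const (Poly_Mapping.lookup p m) *
     (\<Prod>k\<in>Poly_Mapping.keys m. f k ^ Poly_Mapping.lookup m k))"

definition GL :: "nat \<Rightarrow> 'a::field mat set" where
  "GL n = {g \<in> carrier_mat n n. invertible_mat g}"

definition act :: "'a::field mat \<Rightarrow> 'a mpoly \<Rightarrow> 'a mpoly" where
  "act g = subst (\<lambda>k. \<Sum>i<dim_row g. Const (g $$ (i, k)) * Var i)"


section \<open>Invariants and coinvariants\<close>

definition invariant_ring :: "nat \<Rightarrow> 'a::field mat set \<Rightarrow> 'a mpoly ring" where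
  "invariant_ring n G =
     (poly_ring n)\<lparr>carrier := {p \<in> carrier (poly_ring n). \<forall>g\<in>G. act g p = p}\<rparr>"

definition hilbert_ideal :: "nat \<Rightarrow> 'a::field mat set \<Rightarrow> 'a mpoly set" where
  "hilbert_ideal n G =
     Idl\<^bsub>poly_ring n\<^esub> {p \<in> carrier (invariant_ring n G). \<exists>d>0. homogeneous d p}"

definition coinvariant_ring :: "nat \<Rightarrow> 'a::field mat set \<Rightarrow> 'a mpoly set ring" where
  "coinvariant_ring n G = poly_ring n Quot hilbert_ideal n G"

definition coinvariant_proj :: "nat \<Rightarrow> 'a::field mat set \<Rightarrow> 'a mpoly \<Rightarrow> 'a mpoly set" where
  "coinvariant_proj n G p = hilbert_ideal n G +>\<^bsub>poly_ring n\<^esub> p"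


section \<open>Bases\<close>

text \<open>
  \<open>scalars_via h S\<close> is the ring \<open>S\<close> made into a module along a ring homomorphism \<open>h\<close> into \<open>S\<close>.
\<close>

definition scalars_via :: "('r \<Rightarrow> 's) \<Rightarrow> 's ring \<Rightarrow> ('r, 's) module" where
  "scalars_via h S = \<lparr>carrier = carrier S, monoid.mult = monoid.mult S, one = one S,
     zero = zero S, add = add S, smult = (\<lambda>a x. h a \<otimes>\<^bsub>S\<^esub> x)\<rparr>"

text \<open>
  \<open>module.span\<close> and \<open>module.lin_dep\<close> are only meaningful for an actual module,
  hence the first conjunct.
\<close>

definition module_basis :: "('r, 'b) ring_scheme \<Rightarrow> ('r, 's, 'c) module_scheme \<Rightarrow> 's set \<Rightarrow> bool" where
  "module_basis R M B \<longleftrightarrow> Module.module R M \<and> B \<subseteq> carrier M \<and>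
     LinearCombinations.module.span R M B = carrier M \<and> \<not> LinearCombinations.module.lin_dep R M B"

definition monomial_factors :: "nat \<Rightarrow> 'a::comm_ring_1 mpoly \<Rightarrow> 'a mpoly set" where
  "monomial_factors n f = {t. (\<exists>e. t = monomial n e) \<and> t divides\<^bsub>poly_ring n\<^esub> f}"

text \<open>
  The factors form a basis as a family, so distinct factors must have distinct residue classes.
\<close>

definition generates_block_basis :: "nat \<Rightarrow> 'a::field mat set \<Rightarrow> 'a mpoly \<Rightarrow> bool" where
  "generates_block_basis n G f \<longleftrightarrow>
     (\<exists>e. f = monomial n e) \<and>
     inj_on (coinvariant_proj n G) (monomial_factors n f) \<and>
     module_basis (class_ring :: 'a ring)
       (scalars_via (\<lambda>c. coinvariant_proj n G (Const c)) (coinvariant_ring n G))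
       (coinvariant_proj n G ` monomial_factors n f)"


section \<open>Compositions and block unitriangular groups\<close>

definition composition :: "nat list \<Rightarrow> nat \<Rightarrow> bool" where
  "composition I n \<longleftrightarrow> (\<forall>a\<in>set I. 1 \<le> a) \<and> sum_list I = n"

text \<open>\<open>psum I j\<close> is \<open>m\<^sub>j\<close>, the sum of the first \<open>j\<close> parts.\<close>

definition psum :: "nat list \<Rightarrow> nat \<Rightarrow> nat" where
  "psum I j = sum_list (take j I)"

text \<open>
  For a 0-based position \<open>k\<close>, corresponding to \<open>s = k + 1\<close>, the condition
  \<open>m\<^sub>j < s \<le> m\<^sub>j\<^sub>+\<^sub>1\<close> reads \<open>m\<^sub>j \<le> k < m\<^sub>j\<^sub>+\<^sub>1\<close>.  Thus \<open>tau I k\<close> is \<open>\<tau>(k + 1)\<close>.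
\<close>

definition block :: "nat list \<Rightarrow> nat \<Rightarrow> nat" where
  "block I k = (THE j. j < length I \<and> psum I j \<le> k \<and> k < psum I (Suc j))"

definition tau :: "nat list \<Rightarrow> nat \<Rightarrow> nat" where
  "tau I k = psum I (block I k)"

definition block_unitriangular :: "nat list \<Rightarrow> 'a::field mat set" where
  "block_unitriangular I = {g \<in> GL (sum_list I). \<forall>i<sum_list I. \<forall>k<sum_list I.
     (block I k < block I i \<longrightarrow> g $$ (i, k) = 0) \<and>
     (block I i = block I k \<longrightarrow> g $$ (i, k) = (if i = k then 1 else 0))}"

definition Psi :: "nat \<Rightarrow> nat list \<Rightarrow> 'a::comm_ring_1 mpoly set" where
  "Psi q I = {monomial (sum_list I) e | e. \<forall>k<sum_list I. e k < q ^ tau I k}"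

definition f_top :: "nat \<Rightarrow> nat list \<Rightarrow> 'a::comm_ring_1 mpoly" where
  "f_top q I = monomial (sum_list I) (\<lambda>k. q ^ tau I k - 1)"

end

theory Submission
  imports Defs
begin

text \<open>
  Under \<open>U\<^sub>I\<close> the images of \<open>x\<^sub>k\<close> form the set \<open>S\<^sub>k = x\<^sub>k + \<langle>x\<^sub>1, \<dots>, x\<^bsub>\<tau>(k)\<^esub>\<rangle>\<close> of
  size \<open>q\<^bsup>\<tau>(k)\<^esup>\<close>, and the images of the different variables can be prescribed
  independently.  The product of \<open>S\<^sub>k\<close> is a homogeneous invariant which is monic of degree
  \<open>q\<^bsup>\<tau>(k)\<^esup>\<close> in \<open>x\<^sub>k\<close> over the polynomials in the earlier variables, so division by these
  products shows that \<open>\<Psi>\<^sub>n\<close> spans over the invariants, and over the field modulo the Hilbert ideal.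
  An invariant relation between the elements of \<open>\<Psi>\<^sub>n\<close> becomes, on applying all of
  \<open>U\<^sub>I\<close>, a polynomial in \<open>n\<close> unknowns of degree below \<open>|S\<^sub>k|\<close> in the \<open>k\<close>-th one that vanishes on
  the grid \<open>S\<^sub>1 \<times> \<dots> \<times> S\<^sub>n\<close>, hence it is trivial.  Modulo the Hilbert ideal independence follows,
  since every element of that ideal has \<open>\<Psi>\<^sub>n\<close>-coordinates with vanishing constant term.
\<close>

section \<open>Substitution and monomials\<close>

lemma Const_0 [simp]: "Const 0 = 0"
  and Const_1 [simp]: "Const 1 = 1"
  and Const_add: "Const (a + b) = Const a + Const b"
  and Const_mult: "Const (a * b) = Const a * Const b"
  and Const_uminus: "Const (- a) = - Const a"
  by (simp_all add: Const_def single_add mult_single single_uminus)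

text \<open>Building a polynomial up term by term reduces additive claims to single terms. The terms
  need not have distinct exponents, which suits bilinear arguments.\<close>

lemma mpoly_induct [case_names single add]:
  fixes p :: "'a::comm_ring_1 mpoly"
  assumes "\<And>m c. P (Poly_Mapping.single m c)"
    and "\<And>p q. P p \<Longrightarrow> P q \<Longrightarrow> P (p + q)"
  shows "P p"
proof (induction p rule: update_induct)
  case const
  show ?case using assms(1)[of 0 0] by simp
next
  case (update p m c)
  have "Poly_Mapping.update m c p = Poly_Mapping.single m c + p"
    using update.hyps
    by (intro poly_mapping_eqI) (auto simp: lookup_update lookup_add lookup_single when_def in_keys_iff)
  then show ?case using assms update.IH by simp
qed

lemma mpoly_eq_sum_single:
  fixes p :: "'a::comm_ring_1 mpoly"
  shows "p = (\<Sum>m\<in>Poly_Mapping.keys p. Poly_Mapping.single m (Poly_Mapping.lookup p m))"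
  by (intro poly_mapping_eqI) (auto simp: lookup_sum lookup_single when_def in_keys_iff)

lemma lookup_Const_mult:
  "Poly_Mapping.lookup (Const c * p) m = c * Poly_Mapping.lookup p m"
proof -
  have "Const c * p = Poly_Mapping.map ((*) c) p"
    by (simp add: Const_def mult_map_scale_conv_mult)
  then show ?thesis
    by (simp add: Poly_Mapping.map.rep_eq when_def)
qed

text \<open>All three products can be taken over the union of the two supports, since the extra
  factors are zeroth powers; there the power law applies. This is multiplicativity of substitution
  on single terms.\<close>

lemma prod_lookup_keys_add:
  fixes f :: "nat \<Rightarrow> 'b::comm_monoid_mult" and m m' :: "nat \<Rightarrow>\<^sub>0 nat"
  shows "(\<Prod>k\<in>Poly_Mapping.keys (m + m'). f k ^ Poly_Mapping.lookup (m + m') k) =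
    (\<Prod>k\<in>Poly_Mapping.keys m. f k ^ Poly_Mapping.lookup m k) *
    (\<Prod>k\<in>Poly_Mapping.keys m'. f k ^ Poly_Mapping.lookup m' k)"
proof -
  define A where "A = Poly_Mapping.keys m \<union> Poly_Mapping.keys m'"
  have ext: "(\<Prod>k\<in>Poly_Mapping.keys l. f k ^ Poly_Mapping.lookup l k) =
      (\<Prod>k\<in>A. f k ^ Poly_Mapping.lookup l k)" if "Poly_Mapping.keys l \<subseteq> A" for l
    using that by (intro prod.mono_neutral_left) (auto simp: A_def in_keys_iff)
  show ?thesis
    using keys_add[of m m']
    by (subst (1 2 3) ext) (auto simp: A_def lookup_add power_add prod.distrib)
qed

lemma subst_add: "subst f (p + q) = subst f p + subst f q"
  unfolding subst_def
  by (rule setsum_keys_plus_distrib) (simp_all add: Const_add distrib_right)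

lemma subst_0 [simp]: "subst f 0 = 0"
  by (simp add: subst_def)

lemma subst_single:
  "subst f (Poly_Mapping.single m c) =
    Const c * (\<Prod>k\<in>Poly_Mapping.keys m. f k ^ Poly_Mapping.lookup m k)"
  by (simp add: subst_def)

lemma subst_mult: "subst f (p * q) = subst f p * subst f q"
proof (induction p rule: mpoly_induct)
  case (single m c)
  show ?case
  proof (induction q rule: mpoly_induct)
    case (single m' c')
    show ?case
      by (simp add: mult_single subst_single prod_lookup_keys_add Const_mult mult_ac)
  qed (simp add: subst_add distrib_left)
qed (simp add: subst_add distrib_right)

lemma subst_Const [simp]: "subst f (Const c) = Const c"
  by (simp add: Const_def subst_single)

lemma subst_1 [simp]: "subst f 1 = 1"
  using subst_Const[of f 1] by simp

lemma subst_Var [simp]: "subst f (Var k) = f k"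
  by (simp add: Var_def subst_single)

lemma subst_sum: "subst f (\<Sum>i\<in>A. p i) = (\<Sum>i\<in>A. subst f (p i))"
  by (induction A rule: infinite_finite_induct) (simp_all add: subst_add)

lemma subst_prod: "subst f (\<Prod>i\<in>A. p i) = (\<Prod>i\<in>A. subst f (p i))"
  by (induction A rule: infinite_finite_induct) (simp_all add: subst_mult)

lemma subst_power: "subst f (p ^ j) = subst f p ^ j"
  by (induction j) (simp_all add: subst_mult)

lemma subst_uminus: "subst f (- p) = - subst f p"
  using subst_add[of f p "- p"] by (simp add: eq_neg_iff_add_eq_0 add.commute)

section \<open>The ring of polynomials in the first \<open>n\<close> variables\<close>

lemma mem_poly_ring:
  "p \<in> carrier (poly_ring n) \<longleftrightarrow>
    (\<forall>m\<in>Poly_Mapping.keys p. Poly_Mapping.keys m \<subseteq> {..<n})"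
  by (simp add: poly_ring_def)

lemma poly_ring_simps [simp]:
  "monoid.mult (poly_ring n) = (*)" "one (poly_ring n) = 1"
  "zero (poly_ring n) = 0" "add (poly_ring n) = (+)"
  by (simp_all add: poly_ring_def)

lemma poly_ring_0: "0 \<in> carrier (poly_ring n)"
  by (simp add: mem_poly_ring)

lemma poly_ring_Const: "Const c \<in> carrier (poly_ring n)"
  by (simp add: mem_poly_ring Const_def)

lemma poly_ring_1: "1 \<in> carrier (poly_ring n)"
  using poly_ring_Const[of 1] by simp

lemma poly_ring_Var: "k < n \<Longrightarrow> Var k \<in> carrier (poly_ring n)"
  by (simp add: mem_poly_ring Var_def)

lemma poly_ring_add:
  "p \<in> carrier (poly_ring n) \<Longrightarrow> q \<in> carrier (poly_ring n) \<Longrightarrow> p + q \<in> carrier (poly_ring n)"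
  using keys_add[of p q] by (auto simp: mem_poly_ring)

lemma poly_ring_mult:
  assumes "p \<in> carrier (poly_ring n)" "q \<in> carrier (poly_ring n)"
  shows "p * q \<in> carrier (poly_ring n)"
  unfolding mem_poly_ring
proof
  fix m assume "m \<in> Poly_Mapping.keys (p * q)"
  then obtain a b where "m = a + b" "a \<in> Poly_Mapping.keys p" "b \<in> Poly_Mapping.keys q"
    using keys_mult[of p q] by blast
  then show "Poly_Mapping.keys m \<subseteq> {..<n}"
    using assms keys_add[of a b] by (fastforce simp: mem_poly_ring)
qed

lemma poly_ring_uminus: "p \<in> carrier (poly_ring n) \<Longrightarrow> - p \<in> carrier (poly_ring n)"
  using poly_ring_mult[OF poly_ring_Const[of "-1"], of p n] by (simp add: Const_uminus)

lemma poly_ring_sum: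
  "(\<And>i. i \<in> A \<Longrightarrow> p i \<in> carrier (poly_ring n)) \<Longrightarrow> (\<Sum>i\<in>A. p i) \<in> carrier (poly_ring n)"
  by (induction A rule: infinite_finite_induct) (auto intro: poly_ring_0 poly_ring_add)

lemma poly_ring_prod:
  "(\<And>i. i \<in> A \<Longrightarrow> p i \<in> carrier (poly_ring n)) \<Longrightarrow> (\<Prod>i\<in>A. p i) \<in> carrier (poly_ring n)"
  by (induction A rule: infinite_finite_induct) (auto intro: poly_ring_1 poly_ring_mult)

lemma poly_ring_power: "p \<in> carrier (poly_ring n) \<Longrightarrow> p ^ j \<in> carrier (poly_ring n)"
  by (induction j) (auto intro: poly_ring_1 poly_ring_mult)

lemma poly_ring_mono: "m \<le> n \<Longrightarrow> carrier (poly_ring m) \<subseteq> carrier (poly_ring n)"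
  by (fastforce simp: mem_poly_ring)

lemma cring_poly_ring: "cring (poly_ring n)"
proof (intro cringI abelian_groupI comm_monoidI)
  fix p :: "'a mpoly" assume "p \<in> carrier (poly_ring n)"
  then show "\<exists>q\<in>carrier (poly_ring n). q \<oplus>\<^bsub>poly_ring n\<^esub> p = \<zero>\<^bsub>poly_ring n\<^esub>"
    by (intro bexI[of _ "- p"]) (auto intro: poly_ring_uminus)
qed (auto intro: poly_ring_0 poly_ring_1 poly_ring_add poly_ring_mult simp: algebra_simps)

section \<open>Monomials as single terms with a truncated exponent vector\<close>

definition expo :: "nat \<Rightarrow> (nat \<Rightarrow> nat) \<Rightarrow> nat \<Rightarrow>\<^sub>0 nat" where
  "expo n e = (\<Sum>k<n. Poly_Mapping.single k (e k))"

lemma lookup_expo: "Poly_Mapping.lookup (expo n e) k = (if k < n then e k else 0)"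
  by (auto simp: expo_def lookup_sum lookup_single when_def)

lemma Var_power: "Var k ^ j = Poly_Mapping.single (Poly_Mapping.single k j) 1"
proof (induction j)
  case (Suc j)
  then show ?case
    by (simp add: Var_def mult_single flip: single_add)
qed simp

lemma monomial_eq_single: "monomial n e = Poly_Mapping.single (expo n e) 1"
proof (induction n)
  case (Suc n)
  then show ?case
    by (simp add: monomial_def expo_def Var_power mult_single)
qed (simp add: monomial_def expo_def)

lemma monomial_eq_iff:
  "monomial n e = (monomial n e' :: 'a::comm_ring_1 mpoly) \<longleftrightarrow> (\<forall>k<n. e k = e' k)"
proof
  assume "monomial n e = (monomial n e' :: 'a mpoly)"
  then have "Poly_Mapping.lookup (monomial n e :: 'a mpoly) (expo n e) = Poly_Mapping.lookup (monomial n e') (expo n e)"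
    by simp
  then have "expo n e = expo n e'"
    by (auto simp: monomial_eq_single lookup_single when_def split: if_splits)
  then show "\<forall>k<n. e k = e' k"
    by (metis lookup_expo)
qed (simp add: monomial_def)

lemma poly_ring_monomial: "monomial n e \<in> carrier (poly_ring n)"
  unfolding monomial_def by (intro poly_ring_prod poly_ring_power poly_ring_Var) simp

lemma monomial_mult: "monomial n e * monomial n e' = monomial n (\<lambda>k. e k + e' k)"
  by (simp add: monomial_def power_add prod.distrib)

lemma single_eq_monomial:
  assumes "Poly_Mapping.keys m \<subseteq> {..<n}"
  shows "Poly_Mapping.single m c = Const c * monomial n (Poly_Mapping.lookup m)"
proof -
  have "expo n (Poly_Mapping.lookup m) = m"
    using assms by (intro poly_mapping_eqI) (force simp: lookup_expo in_keys_iff)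
  then show ?thesis by (simp add: monomial_eq_single Const_def mult_single)
qed


section \<open>Linear forms and the block unitriangular group\<close>

lemma psum_mono: "i \<le> j \<Longrightarrow> psum I i \<le> psum I j"
  using take_add[of i "j - i" I] by (simp add: psum_def)

text \<open>Justifies the definite description in \<open>block\<close>. Existence comes from the
  least \<open>l\<close> with \<open>k < psum I l\<close>, which is a successor because
  \<open>psum I 0 = 0\<close>; uniqueness comes from monotonicity of the partial sums.\<close>

lemma block_props:
  assumes "k < sum_list I"
  shows "block I k < length I" "psum I (block I k) \<le> k" "k < psum I (Suc (block I k))"
proof -
  let ?P = "\<lambda>j. j < length I \<and> psum I j \<le> k \<and> k < psum I (Suc j)"
  define l where "l = (LEAST j. k < psum I j)"
  have top: "k < psum I (length I)" using assms by (simp add: psum_def)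
  have l: "k < psum I l" "l \<le> length I"
    unfolding l_def using top by (auto intro: LeastI Least_le)
  have "l \<noteq> 0" using l(1) by (cases l) (auto simp: psum_def)
  then obtain j where j: "l = Suc j" by (cases l) auto
  have "psum I j \<le> k" using not_less_Least[of j "\<lambda>j. k < psum I j"] j by (force simp: l_def)
  then have "?P j" using l j by auto
  moreover have "i = j" if "?P i" "?P j" for i j
    using that psum_mono[of "Suc i" j I] psum_mono[of "Suc j" i I]
    by (cases i j rule: linorder_cases) auto
  ultimately have "?P (block I k)" unfolding block_def by (intro theI[of ?P j])
  then show "block I k < length I" "psum I (block I k) \<le> k" "k < psum I (Suc (block I k))" by auto
qed

lemma tau_le: "k < sum_list I \<Longrightarrow> tau I k \<le> k"
  unfolding tau_def by (rule block_props)

text \<open>\<open>tau I k\<close> is the first index of the block of \<open>k\<close>, so the block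
  shape of a matrix can be read off from numerical comparisons.\<close>

lemma less_tau_iff:
  assumes "i < sum_list I" "k < sum_list I"
  shows "i < tau I k \<longleftrightarrow> block I i < block I k"
  using block_props[OF assms(1)] psum_mono[of "Suc (block I i)" "block I k" I]
    psum_mono[of "block I k" "block I i" I]
  unfolding tau_def by (cases "block I i < block I k") auto

section \<open>Linear forms and the orbits of the variables\<close>

definition linear_form :: "nat \<Rightarrow> (nat \<Rightarrow> 'a::comm_ring_1) \<Rightarrow> 'a mpoly" where
  "linear_form n c = (\<Sum>i<n. Const (c i) * Var i)"

lemma single_one_eq_iff:
  "Poly_Mapping.single i (1::nat) = Poly_Mapping.single k 1 \<longleftrightarrow> i = k"
  using keys_single[of i "1::nat"] keys_single[of k "1::nat"] by fastforce

lemma linear_form_add: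
  "linear_form n c + linear_form n d = linear_form n (\<lambda>i. c i + d i)"
  by (simp add: linear_form_def sum.distrib Const_add distrib_right)

lemma linear_form_Const_mult:
  "Const a * linear_form n c = linear_form n (\<lambda>i. a * c i)"
  by (simp add: linear_form_def sum_distrib_left Const_mult mult_ac)

lemma linear_form_extend:
  "m \<le> n \<Longrightarrow> linear_form m c = linear_form n (\<lambda>i. if i < m then c i else 0)"
  unfolding linear_form_def by (intro sum.mono_neutral_cong_left) auto

lemma Var_eq_linear_form:
  assumes "k < n"
  shows "Var k = linear_form n (\<lambda>i. if i = k then 1 else 0)"
proof -
  have "linear_form n (\<lambda>i. if i = k then 1 else 0) = (\<Sum>i<n. if i = k then Var i else 0)"
    unfolding linear_form_def by (intro sum.cong) auto
  also have "\<dots> = Var k" using assms by simp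
  finally show ?thesis by (rule sym)
qed

text \<open>Coefficients can be read back from a linear form, which gives the injectivity used for
  counting.\<close>

lemma lookup_linear_form:
  "Poly_Mapping.lookup (linear_form n c) (Poly_Mapping.single k 1) = (if k < n then c k else 0)"
proof -
  have *: "Poly_Mapping.lookup (Const (c i) * Var i) (Poly_Mapping.single k 1) =
      (if i = k then c i else 0)" for i
    using single_one_eq_iff[of i k] by (simp add: lookup_Const_mult Var_def lookup_single when_def)
  show ?thesis
    by (simp add: linear_form_def lookup_sum * del: One_nat_def)
qed

lemma poly_ring_linear_form: "linear_form n c \<in> carrier (poly_ring n)"
  unfolding linear_form_def by (intro poly_ring_sum poly_ring_mult poly_ring_Const poly_ring_Var) simp

text \<open>The set S_k of the opening comment, the orbit of \<open>Var k\<close>, with indices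
  counted from 0. It serves both as the set of factors of an invariant and as one side of the grid
  of evaluation points.\<close>

definition root_set :: "nat list \<Rightarrow> nat \<Rightarrow> 'a::comm_ring_1 mpoly set" where
  "root_set I k = (\<lambda>v. Var k + v) ` range (linear_form (tau I k))"

text \<open>Coefficients from \<open>n\<close> on do not affect the form, so the infinite type of
  coefficient functions may be replaced by a finite set of extensional ones.\<close>

lemma range_linear_form:
  "range (linear_form n :: _ \<Rightarrow> 'a::comm_ring_1 mpoly) = linear_form n ` ({..<n} \<rightarrow>\<^sub>E UNIV)"
proof -
  have "linear_form n c = linear_form n (restrict c {..<n})" for c :: "nat \<Rightarrow> 'a"
    by (simp add: linear_form_def)
  then have "linear_form n c \<in> linear_form n ` ({..<n} \<rightarrow>\<^sub>E UNIV)" for c :: "nat \<Rightarrow> 'a"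
    by (metis imageI restrict_PiE_iff UNIV_I)
  then show ?thesis by blast
qed

lemma inj_on_linear_form: "inj_on (linear_form n) ({..<n} \<rightarrow>\<^sub>E UNIV)"
proof (rule inj_onI)
  fix c d :: "nat \<Rightarrow> 'a"
  assume cd: "c \<in> {..<n} \<rightarrow>\<^sub>E UNIV" "d \<in> {..<n} \<rightarrow>\<^sub>E UNIV"
    and eq: "linear_form n c = linear_form n d"
  show "c = d"
  proof (rule PiE_ext[OF cd])
    fix k assume "k \<in> {..<n}"
    then show "c k = d k"
      using lookup_linear_form[of n c k] lookup_linear_form[of n d k] eq by simp
  qed
qed

lemma finite_root_set: "finite (root_set I k :: 'a::{comm_ring_1,finite} mpoly set)"
  by (auto simp: root_set_def range_linear_form intro!: finite_PiE)

lemma card_root_set: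
  "card (root_set I k :: 'a::{comm_ring_1,finite} mpoly set) = CARD('a) ^ tau I k"
proof -
  have "card (root_set I k :: 'a mpoly set) =
      card ({..<tau I k} \<rightarrow>\<^sub>E (UNIV :: 'a set))"
    unfolding root_set_def range_linear_form
    by (subst card_image, simp)+ (simp add: card_image inj_on_linear_form)
  then show ?thesis by (simp add: card_PiE)
qed

section \<open>The group action on variables and linear forms\<close>

lemma act_add: "act g (p + q) = act g p + act g q"
  by (simp add: act_def subst_add)

lemma act_Var:
  assumes g: "g \<in> block_unitriangular I" and k: "k < sum_list I"
  shows "act g (Var k) = Var k + linear_form (tau I k) (\<lambda>i. g $$ (i, k))"
proof -
  let ?N = "sum_list I"
  have dim: "dim_row g = ?N" using g by (auto simp: block_unitriangular_def GL_def)
  \<comment> \<open>A row \<open>i\<close> with \<open>tau I k \<le> i\<close> lies in the block of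
    \<open>k\<close> or in a later one, and there the entry is the Kronecker delta.\<close>
  have entry: "g $$ (i, k) = (if i < tau I k then g $$ (i, k) else 0) + (if i = k then 1 else 0)"
    if i: "i < ?N" for i
  proof (cases "i < tau I k")
    case True
    then show ?thesis using tau_le[OF k] by auto
  next
    case False
    then have "block I k \<le> block I i" using less_tau_iff[OF i k] by simp
    then show ?thesis
      using g i k False unfolding block_unitriangular_def by (cases "block I i = block I k") auto
  qed
  have "act g (Var k) = linear_form ?N (\<lambda>i. g $$ (i, k))"
    by (simp add: act_def dim linear_form_def)
  also have "\<dots> = linear_form ?N (\<lambda>i. (if i < tau I k then g $$ (i, k) else 0) + (if i = k then 1 else 0))"
    unfolding linear_form_def using entry by (intro sum.cong) auto
  also have "\<dots> = linear_form (tau I k) (\<lambda>i. g $$ (i, k)) + Var k"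
    using k tau_le[OF k]
    by (simp add: Var_eq_linear_form[OF k] linear_form_extend[of "tau I k" ?N] flip: linear_form_add)
  finally show ?thesis by (simp add: add.commute)
qed

text \<open>The condition on \<open>t\<close> makes the span of the first \<open>t\<close> variables
  stable: the image of \<open>Var i\<close> adds only variables below \<open>tau I i\<close>. It is
  applied with \<open>t\<close> equal to some \<open>tau I k\<close>.\<close>

lemma act_linear_form_mem:
  assumes g: "g \<in> block_unitriangular I" and t: "t \<le> sum_list I" "\<And>i. i < t \<Longrightarrow> tau I i \<le> t"
  shows "act g (linear_form t c) \<in> range (linear_form t)"
proof -
  have add: "p + q \<in> range (linear_form t)" if "p \<in> range (linear_form t)" "q \<in> range (linear_form t)" for p q
    using that by (auto simp: linear_form_add)
  have scale: "Const a * p \<in> range (linear_form t)" if "p \<in> range (linear_form t)" for p a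
    using that by (auto simp: linear_form_Const_mult)
  have zero: "0 \<in> range (linear_form t)"
    by (rule image_eqI[of _ _ "\<lambda>_. 0"]) (auto simp: linear_form_def)
  have var: "act g (Var i) \<in> range (linear_form t)" if "i < t" for i
    using that t(1) by (subst act_Var[OF g])
      (auto intro!: add simp: Var_eq_linear_form[OF that] linear_form_extend[OF t(2)[OF that]])
  have "(\<Sum>i\<in>A. Const (c i) * act g (Var i)) \<in> range (linear_form t)" if "A \<subseteq> {..<t}" for A
    using that by (induction A rule: infinite_finite_induct) (auto intro!: add scale var simp: zero)
  moreover have "act g (linear_form t c) = (\<Sum>i<t. Const (c i) * act g (Var i))"
    by (simp add: act_def linear_form_def[of t c] subst_sum subst_mult)
  ultimately show ?thesis by simp
qed

lemma act_root_set:
  assumes g: "g \<in> block_unitriangular I" and k: "k < sum_list I" and y: "y \<in> root_set I k"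
  shows "act g y \<in> root_set I k"
proof -
  obtain c where y: "y = Var k + linear_form (tau I k) c" using y by (auto simp: root_set_def)
  have "tau I k \<le> sum_list I" using tau_le[OF k] k by simp
  moreover have "tau I i \<le> tau I k" if "i < tau I k" for i
    using that tau_le[of i I] tau_le[OF k] k by simp
  ultimately obtain d where d: "act g (linear_form (tau I k) c) = linear_form (tau I k) d"
    using act_linear_form_mem[OF g] by blast
  have "act g y = Var k + linear_form (tau I k) (\<lambda>i. g $$ (i, k) + d i)"
    using act_Var[OF g k] d by (simp add: y act_add add.assoc linear_form_add)
  then show ?thesis by (auto simp: root_set_def)
qed

text \<open>Acting with the inverse matrix undoes \<open>g\<close> on each variable, hence on all
  linear forms, and the root sets consist of linear forms.\<close>

lemma inj_on_act_linear_form: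
  assumes g: "g \<in> GL n"
  shows "inj_on (act g) (range (linear_form n))"
proof -
  obtain B where gB: "g * B = 1\<^sub>m (dim_row g)" and Bg: "B * g = 1\<^sub>m (dim_row B)"
    using g by (auto simp: GL_def invertible_mat_def inverts_mat_def)
  have gc: "g \<in> carrier_mat n n" using g by (simp add: GL_def)
  \<comment> \<open>The shape of the inverse is recovered by comparing the column counts in the two
    product identities.\<close>
  have B: "B \<in> carrier_mat n n"
    using gc arg_cong[OF gB, of dim_col] arg_cong[OF Bg, of dim_col] by auto
  have var: "act B (act g (Var k)) = Var k" if k: "k < n" for k
  proof -
    have "act B (act g (Var k)) = (\<Sum>i<n. Const (g $$ (i, k)) * (\<Sum>j<n. Const (B $$ (j, i)) * Var j))"
      using gc B by (simp add: act_def subst_sum subst_mult)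
    also have "\<dots> = (\<Sum>j<n. (\<Sum>i<n. Const (B $$ (j, i) * g $$ (i, k))) * Var j)"
      unfolding sum_distrib_left sum_distrib_right
      by (subst sum.swap) (simp add: Const_mult mult_ac)
    also have "\<dots> = (\<Sum>j<n. Const ((B * g) $$ (j, k)) * Var j)"
    proof (intro sum.cong refl arg_cong2[of _ _ _ _ "(*)"])
      fix j assume "j \<in> {..<n}"
      then have "(B * g) $$ (j, k) = (\<Sum>i<n. B $$ (j, i) * g $$ (i, k))"
        using gc B k by (simp add: scalar_prod_def atLeast0LessThan)
      moreover have "Const (sum h A) = (\<Sum>i\<in>A. Const (h i))" for h :: "nat \<Rightarrow> 'a" and A
        by (induction A rule: infinite_finite_induct) (simp_all add: Const_add)
      ultimately show "(\<Sum>i<n. Const (B $$ (j, i) * g $$ (i, k))) = Const ((B * g) $$ (j, k))"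
        by simp
    qed
    also have "\<dots> = Var k"
      using k B by (simp add: Bg Var_eq_linear_form[OF k] linear_form_def)
    finally show ?thesis .
  qed
  have "act B (act g (linear_form n c)) = linear_form n c" for c
    using var unfolding act_def linear_form_def by (simp add: subst_sum subst_mult)
  then show ?thesis by (intro inj_on_inverseI[of _ "act B"]) auto
qed

lemma root_set_subset:
  assumes "k < sum_list I"
  shows "root_set I k \<subseteq> range (linear_form (sum_list I))"
  using tau_le[OF assms] assms
  by (auto simp: root_set_def Var_eq_linear_form[OF assms] linear_form_extend[of "tau I k" "sum_list I"]
      linear_form_add)

section \<open>Orbit products: invariance, homogeneity and leading power\<close>

definition orbit_prod :: "nat list \<Rightarrow> nat \<Rightarrow> 'a::comm_ring_1 mpoly" where
  "orbit_prod I k = \<Prod>(root_set I k)"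

text \<open>An injective map of a finite set into itself is a permutation, so \<open>g\<close> only
  reorders the factors.\<close>

lemma act_orbit_prod:
  fixes g :: "'a::{field,finite} mat"
  assumes g: "g \<in> block_unitriangular I" and k: "k < sum_list I"
  shows "act g (orbit_prod I k) = orbit_prod I k"
proof -
  have inj: "inj_on (act g) (root_set I k)"
    using inj_on_act_linear_form[of g "sum_list I"] root_set_subset[OF k] g
    by (auto simp: block_unitriangular_def intro: inj_on_subset)
  have im: "act g ` root_set I k = root_set I k"
    using act_root_set[OF g k] inj by (intro endo_inj_surj finite_root_set) auto
  have "act g (orbit_prod I k) = (\<Prod>y\<in>root_set I k. act g y)"
    by (simp add: orbit_prod_def act_def subst_prod)
  also have "\<dots> = \<Prod>(act g ` root_set I k)"
    by (simp add: prod.reindex[OF inj])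
  finally show ?thesis by (simp add: im orbit_prod_def)
qed

lemma poly_ring_orbit_prod:
  assumes "k < sum_list I"
  shows "orbit_prod I k \<in> carrier (poly_ring (sum_list I))"
  unfolding orbit_prod_def
  using root_set_subset[OF assms] poly_ring_linear_form by (intro poly_ring_prod) blast

lemma homogeneous_linear_form: "homogeneous 1 (linear_form n c)"
  unfolding homogeneous_def
proof
  fix m assume "m \<in> Poly_Mapping.keys (linear_form n c)"
  then have "\<exists>i<n. Poly_Mapping.lookup (Const (c i) * Var i) m \<noteq> 0"
    by (auto simp: in_keys_iff linear_form_def lookup_sum dest: sum.not_neutral_contains_not_neutral)
  then obtain i where "m = Poly_Mapping.single i 1"
    by (auto simp: lookup_Const_mult Var_def lookup_single when_def split: if_splits)
  then show "(\<Sum>k\<in>Poly_Mapping.keys m. Poly_Mapping.lookup m k) = 1" by simp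
qed

lemma homogeneous_mult:
  assumes "homogeneous d p" "homogeneous e q"
  shows "homogeneous (d + e) (p * q)"
  unfolding homogeneous_def
proof
  fix m assume "m \<in> Poly_Mapping.keys (p * q)"
  then obtain a b where "m = a + b" "a \<in> Poly_Mapping.keys p" "b \<in> Poly_Mapping.keys q"
    using keys_mult[of p q] by blast
  then show "(\<Sum>k\<in>Poly_Mapping.keys m. Poly_Mapping.lookup m k) = d + e"
    using assms setsum_keys_plus_distrib[of "\<lambda>_ x. x" a b] by (simp add: homogeneous_def)
qed

lemma homogeneous_prod:
  assumes "finite A" "\<And>y. y \<in> A \<Longrightarrow> homogeneous 1 (f y)"
  shows "homogeneous (card A) (prod f A)"
  using assms
proof (induction A rule: finite_induct)
  case (insert y A)
  then show ?case using homogeneous_mult[of 1 "f y" "card A" "prod f A"] by simp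
qed (simp add: homogeneous_def)

lemma homogeneous_orbit_prod:
  fixes I :: "nat list"
  assumes "k < sum_list I"
  shows "homogeneous (CARD('a) ^ tau I k) (orbit_prod I k :: 'a::{comm_ring_1,finite} mpoly)"
  unfolding orbit_prod_def card_root_set[symmetric]
  using root_set_subset[OF assms] homogeneous_linear_form
  by (intro homogeneous_prod finite_root_set) blast

text \<open>Multiplying out factor by factor keeps the leading coefficient 1 and the lower
  coefficients in the first \<open>m\<close> variables.\<close>

lemma prod_add_expand:
  fixes x :: "'a::comm_ring_1 mpoly"
  assumes "finite V" "V \<subseteq> carrier (poly_ring m)"
  shows "\<exists>c. (\<forall>i. c i \<in> carrier (poly_ring m)) \<and>
    (\<Prod>v\<in>V. x + v) = x ^ card V + (\<Sum>i<card V. c i * x ^ i)"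
  using assms
proof (induction V rule: finite_induct)
  case empty
  show ?case by (auto intro!: exI[of _ "\<lambda>_. 0"] poly_ring_0)
next
  case (insert v V)
  then obtain c where c: "\<And>i. c i \<in> carrier (poly_ring m)"
    and eq: "(\<Prod>v\<in>V. x + v) = x ^ card V + (\<Sum>i<card V. c i * x ^ i)"
    by auto
  define d where "d = card V"
  \<comment> \<open>Multiplication by \<open>x + v\<close> gives \<open>v\<close> times the old
    coefficient plus the old coefficient one place lower. At \<open>i = d\<close> the old
    coefficient is the leading 1, hence the bare \<open>v\<close>.\<close>
  define c' where "c' = (\<lambda>i. (if i < d then v * c i else v) + (if i = 0 then 0 else c (i - 1)))"
  have shift: "(\<Sum>i<Suc d. (if i = 0 then 0 else c (i - 1)) * x ^ i) = (\<Sum>i<d. c i * x ^ Suc i)"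
    by (simp add: sum.lessThan_Suc_shift del: sum.lessThan_Suc)
  have "(\<Prod>w\<in>insert v V. x + w) = (x + v) * (x ^ d + (\<Sum>i<d. c i * x ^ i))"
    using insert.hyps by (simp add: eq d_def)
  also have "\<dots> = x ^ Suc d + ((\<Sum>i<d. v * c i * x ^ i) + v * x ^ d + (\<Sum>i<d. c i * x ^ Suc i))"
    by (simp add: algebra_simps sum_distrib_left)
  also have "(\<Sum>i<d. v * c i * x ^ i) + v * x ^ d = (\<Sum>i<Suc d. (if i < d then v * c i else v) * x ^ i)"
    by simp
  also have "\<dots> + (\<Sum>i<d. c i * x ^ Suc i) = (\<Sum>i<Suc d. c' i * x ^ i)"
    unfolding shift[symmetric] c'_def by (simp add: distrib_right sum.distrib)
  finally have "(\<Prod>w\<in>insert v V. x + w) = x ^ Suc d + (\<Sum>i<Suc d. c' i * x ^ i)" .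
  moreover have "c' i \<in> carrier (poly_ring m)" for i
    using c insert.prems by (auto simp: c'_def intro!: poly_ring_add poly_ring_mult poly_ring_0)
  ultimately show ?case using insert.hyps by (auto simp: d_def)
qed

text \<open>The monic relation behind the division. Its coefficients involve only variables before
  \<open>Var k\<close> because \<open>tau I k \<le> k\<close>.\<close>

lemma orbit_prod_expand:
  fixes I :: "nat list"
  assumes "k < sum_list I"
  shows "\<exists>c. (\<forall>i. c i \<in> carrier (poly_ring k)) \<and>
    (orbit_prod I k :: 'a::{comm_ring_1,finite} mpoly) =
      Var k ^ (CARD('a) ^ tau I k) + (\<Sum>i<CARD('a) ^ tau I k. c i * Var k ^ i)"
proof -
  let ?V = "range (linear_form (tau I k)) :: 'a mpoly set"
  have inj: "inj_on (\<lambda>v. Var k + v) ?V" by simp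
  have "card ?V = CARD('a) ^ tau I k"
    using card_root_set[where 'a = 'a, of I k] by (simp add: root_set_def card_image)
  moreover have "finite ?V" by (auto simp: range_linear_form intro!: finite_PiE)
  moreover have "?V \<subseteq> carrier (poly_ring k)"
    using poly_ring_linear_form poly_ring_mono[OF tau_le[OF assms]] by blast
  ultimately show ?thesis
    using prod_add_expand[of ?V k "Var k"]
    by (simp add: orbit_prod_def root_set_def prod.reindex[OF inj])
qed

text \<open>The entries above the diagonal blocks are free, so column \<open>k\<close> can carry the
  coefficients of \<open>y k\<close> independently of the other columns.\<close>

lemma exists_block_unitriangular:
  fixes y :: "nat \<Rightarrow> 'a::field mpoly"
  assumes "\<And>k. k < sum_list I \<Longrightarrow> y k \<in> root_set I k"
  shows "\<exists>g\<in>block_unitriangular I. \<forall>k<sum_list I. act g (Var k) = y k"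
proof -
  let ?N = "sum_list I"
  have "\<forall>k<?N. \<exists>c. y k = Var k + linear_form (tau I k) c"
    using assms by (auto simp: root_set_def)
  then obtain c where c: "\<And>k. k < ?N \<Longrightarrow> y k = Var k + linear_form (tau I k) (c k)"
    by metis
  define g where "g = mat ?N ?N (\<lambda>(i, k). if i < tau I k then c k i else if i = k then 1 else 0)"
  have gc: "g \<in> carrier_mat ?N ?N" by (simp add: g_def)
  have entry: "g $$ (i, k) = (if i < tau I k then c k i else if i = k then 1 else 0)"
    if "i < ?N" "k < ?N" for i k using that by (simp add: g_def)
  \<comment> \<open>Invertibility comes from the determinant: by \<open>tau I k \<le> k\<close> the
    matrix is upper triangular with ones on the diagonal.\<close>
  have "upper_triangular g"
  proof (intro upper_triangularI)
    fix i j assume "j < i" "i < dim_row g"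
    then show "g $$ (i, j) = 0" using gc tau_le[of j I] by (auto simp: entry)
  qed
  then have "det g = prod_list (diag_mat g)" using gc by (rule det_upper_triangular)
  also have "\<dots> = 1"
    using gc tau_le[of _ I] unfolding prod_list_diag_prod
    by (intro prod.neutral) (auto simp: entry leD)
  finally have "g \<in> Units (ring_mat TYPE('a) ?N ())"
    using gc by (intro det_non_zero_imp_unit) auto
  then have "invertible_mat g"
    using gc by (auto simp: Units_def ring_mat_def invertible_mat_def inverts_mat_def)
  then have g: "g \<in> block_unitriangular I"
    using gc by (auto simp: block_unitriangular_def GL_def entry less_tau_iff)
  moreover have "act g (Var k) = y k" if k: "k < ?N" for k
    using tau_le[OF k] k by (auto simp: act_Var[OF g k] c linear_form_def entry intro!: sum.cong)
  ultimately show ?thesis by blast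
qed


section \<open>Spanning and independence over the invariants\<close>

abbreviation exponents :: "nat \<Rightarrow> nat list \<Rightarrow> (nat \<Rightarrow> nat) set" where
  "exponents q I \<equiv> PiE {..<sum_list I} (\<lambda>k. {..<q ^ tau I k})"

section \<open>Division by the orbit products\<close>

lemma poly_ring_zeroD:
  assumes "p \<in> carrier (poly_ring 0)"
  shows "p = Const (Poly_Mapping.lookup p 0)"
proof -
  have "Poly_Mapping.keys p \<subseteq> {0}" using assms by (auto simp: mem_poly_ring)
  then show ?thesis
    by (intro poly_mapping_eqI) (auto simp: Const_def lookup_single when_def in_keys_iff)
qed

lemma monomial_eqI: "(\<And>k. k < n \<Longrightarrow> e k = e' k) \<Longrightarrow> monomial n e = monomial n e'"
  by (simp add: monomial_def)

lemma Var_power_mult_monomial: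
  assumes "m < n" "e m = 0"
  shows "Var m ^ j * monomial n e = (monomial n (e(m := j)) :: 'a::comm_ring_1 mpoly)"
proof -
  have "(monomial n f :: 'a mpoly) = Var m ^ f m * (\<Prod>k\<in>{..<n} - {m}. Var k ^ f k)" for f
    using assms(1) by (simp add: monomial_def prod.remove[of "{..<n}" m])
  then show ?thesis using assms(2) by simp
qed

text \<open>The division argument, stated for an arbitrary closed set \<open>M\<close> so that it
  serves twice: for combinations with invariant coefficients, and for combinations with field
  coefficients modulo the Hilbert ideal.\<close>

lemma poly_ring_subset_if_closed:
  fixes M :: "'a::{comm_ring_1,finite} mpoly set"
  assumes add: "\<And>p q. p \<in> M \<Longrightarrow> q \<in> M \<Longrightarrow> p + q \<in> M"
    and scale: "\<And>c p. p \<in> M \<Longrightarrow> Const c * p \<in> M"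
    and orbit: "\<And>k p. k < sum_list I \<Longrightarrow> p \<in> M \<Longrightarrow> orbit_prod I k * p \<in> M"
    and Psi: "Psi CARD('a) I \<subseteq> M"
  shows "carrier (poly_ring (sum_list I)) \<subseteq> M"
proof -
  let ?N = "sum_list I"
  let ?mon = "monomial ?N :: _ \<Rightarrow> 'a mpoly"
  \<comment> \<open>The exponents are already reduced, and the first \<open>m\<close> variables,
    still to be processed, do not occur.\<close>
  let ?ok = "\<lambda>m e. (\<forall>k<?N. e k < CARD('a) ^ tau I k) \<and> (\<forall>k<m. e k = 0)"
  have mon: "?mon e \<in> M" if "?ok m e" for m e
    using that Psi by (auto simp: Psi_def)
  have ok0: "?ok m (\<lambda>_. 0)" for m by simp
  have zero: "0 \<in> M" using scale[OF mon[OF ok0], of 0] by simp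
  have sum: "(\<Sum>i\<in>A. p i) \<in> M" if "\<And>i. i \<in> A \<Longrightarrow> p i \<in> M" for A :: "'i set" and p
    using that by (induction A rule: infinite_finite_induct) (auto intro: add zero)
  have claim: "p * ?mon e \<in> M" if "m \<le> ?N" "p \<in> carrier (poly_ring m)" "?ok m e" for m p e
    using that
  proof (induction m arbitrary: p e)
    case 0
    then have "p * ?mon e = Const (Poly_Mapping.lookup p 0) * ?mon e"
      using poly_ring_zeroD by metis
    then show ?case using scale[OF mon[OF 0(3)]] by simp
  next
    case (Suc m)
    have m: "m < ?N" using Suc.prems by simp
    define d where "d = CARD('a) ^ tau I m"
    obtain c where c: "\<And>i. c i \<in> carrier (poly_ring m)"
      and orb: "orbit_prod I m = Var m ^ d + (\<Sum>i<d. c i * Var m ^ i :: 'a mpoly)"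
      using orbit_prod_expand[OF m, where 'a = 'a] unfolding d_def by blast
    have em: "e m = 0" using Suc.prems by simp
    \<comment> \<open>Strong induction on \<open>j\<close>. A power below \<open>d\<close> is
      absorbed into the reduced monomial, leaving a polynomial in one variable fewer for the outer
      induction.\<close>
    have power: "p' * Var m ^ j * ?mon e \<in> M" if "p' \<in> carrier (poly_ring m)" for p' j
      using that
    proof (induction j arbitrary: p' rule: less_induct)
      case (less j)
      show ?case
      proof (cases "j < d")
        case True
        then have "?ok m (e(m := j))" using Suc.prems by (auto simp: d_def)
        then have "p' * ?mon (e(m := j)) \<in> M" using Suc.IH less.prems m by simp
        then show ?thesis
          using Var_power_mult_monomial[of m ?N e j, where 'a = 'a] m em by (simp add: mult.assoc)
      next
        case False
        let ?r = "p' * Var m ^ (j - d) * ?mon e"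
        have "0 < d" by (simp add: d_def)
        then have r: "?r \<in> M" using False less by simp
        have "p' * Var m ^ j * ?mon e = Var m ^ d * ?r"
          using False by (simp add: mult_ac flip: power_add)
        \<comment> \<open>\<open>Var m ^ d\<close> is the orbit product minus its lower terms; these
          lead to exponents \<open>i + (j - d)\<close>, which are below \<open>j\<close>.\<close>
        also have "\<dots> = orbit_prod I m * ?r + (\<Sum>i<d. Const (- 1) * (c i * Var m ^ i * ?r))"
          by (simp add: orb Const_uminus distrib_right sum_distrib_right sum_negf)
        also have "\<dots> \<in> M"
        proof (intro add orbit sum scale)
          fix i assume "i \<in> {..<d}"
          then have "(c i * p') * Var m ^ (i + (j - d)) * ?mon e \<in> M"
            using False less.prems c by (intro less.IH) (auto intro: poly_ring_mult)
          then show "c i * Var m ^ i * ?r \<in> M" by (simp add: power_add mult_ac)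
        qed (use m r in auto)
        finally show ?thesis .
      qed
    qed
    have "p * ?mon e =
      (\<Sum>l\<in>Poly_Mapping.keys p. Poly_Mapping.single l (Poly_Mapping.lookup p l) * ?mon e)"
      by (subst mpoly_eq_sum_single[of p]) (rule sum_distrib_right)
    also have "\<dots> \<in> M"
    proof (rule sum)
      fix l assume "l \<in> Poly_Mapping.keys p"
      then have "Poly_Mapping.single l (Poly_Mapping.lookup p l) =
          Const (Poly_Mapping.lookup p l) * monomial (Suc m) (Poly_Mapping.lookup l)"
        using Suc.prems(2) by (intro single_eq_monomial) (auto simp: mem_poly_ring)
      also have "\<dots> = Const (Poly_Mapping.lookup p l) * monomial m (Poly_Mapping.lookup l) * Var m ^ Poly_Mapping.lookup l m"
        by (simp add: monomial_def mult.assoc)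
      finally show "Poly_Mapping.single l (Poly_Mapping.lookup p l) * ?mon e \<in> M"
        using power poly_ring_mult[OF poly_ring_Const poly_ring_monomial] by metis
    qed
    finally show ?case .
  qed
  have "p \<in> M" if "p \<in> carrier (poly_ring ?N)" for p
    using claim[OF order_refl that ok0] by (simp add: monomial_def)
  then show ?thesis by blast
qed

section \<open>Polynomials vanishing on a grid\<close>

lemma sum_PiE_Suc:
  "(\<Sum>e\<in>PiE {..<Suc n} D. F e) = (\<Sum>j\<in>D n. \<Sum>e\<in>PiE {..<n} D. F (e(n := j)))"
proof -
  have "PiE {..<Suc n} D = (\<lambda>(j, e). e(n := j)) ` (D n \<times> PiE {..<n} D)"
    by (simp add: lessThan_Suc PiE_insert_eq)
  moreover have "inj_on (\<lambda>(j, e). e(n := j)) (D n \<times> PiE {..<n} D)"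
    by (rule inj_combinator) simp
  ultimately show ?thesis
    by (simp add: sum.reindex sum.cartesian_product case_prod_unfold)
qed

text \<open>With the first \<open>n\<close> coordinates fixed, the sum is a univariate polynomial in
  the last one with more roots than its degree allows. Its coefficients therefore vanish on the
  smaller grid, and the induction hypothesis applies to each.\<close>

lemma vanishing_on_grid:
  fixes a :: "(nat \<Rightarrow> nat) \<Rightarrow> 'b::idom"
  assumes "\<And>k. k < n \<Longrightarrow> finite (S k)" "\<And>k. k < n \<Longrightarrow> d k \<le> card (S k)"
    and "\<And>y. (\<And>k. k < n \<Longrightarrow> y k \<in> S k) \<Longrightarrow>
      (\<Sum>e\<in>PiE {..<n} (\<lambda>k. {..<d k}). a e * (\<Prod>k<n. y k ^ e k)) = 0"
  shows "\<forall>e\<in>PiE {..<n} (\<lambda>k. {..<d k}). a e = 0"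
  using assms
proof (induction n arbitrary: a)
  case 0
  show ?case using 0(3)[of "\<lambda>_. undefined"] by simp
next
  case (Suc n)
  let ?E = "PiE {..<n} (\<lambda>k. {..<d k})"
  have step: "\<forall>e\<in>?E. a (e(n := j)) = 0" if j: "j < d n" for j
  proof (rule Suc.IH[of "\<lambda>e. a (e(n := j))"])
    fix y :: "nat \<Rightarrow> 'b" assume y: "\<And>k. k < n \<Longrightarrow> y k \<in> S k"
    \<comment> \<open>The coefficient of the \<open>j\<close>-th power of the last coordinate,
      evaluated at the fixed point \<open>y\<close>.\<close>
    define b where "b j = (\<Sum>e\<in>?E. a (e(n := j)) * (\<Prod>k<n. y k ^ e k))" for j
    define P where "P = (\<Sum>j<d n. monom (b j) j)"
    have "poly P x = 0" if x: "x \<in> S n" for x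
    proof -
      have "(\<Sum>e\<in>PiE {..<Suc n} (\<lambda>k. {..<d k}). a e * (\<Prod>k<Suc n. (y(n := x)) k ^ e k)) = 0"
        using x y by (intro Suc.prems(3)) (auto simp: less_Suc_eq)
      then have "(\<Sum>j<d n. b j * x ^ j) = 0"
        unfolding sum_PiE_Suc by (simp add: b_def sum_distrib_right mult.assoc)
      then show ?thesis by (simp add: P_def poly_sum poly_monom)
    qed
    then have roots: "S n \<subseteq> {x. poly P x = 0}" by blast
    have "P = 0"
    proof (rule ccontr)
      assume "P \<noteq> 0"
      then have "card (S n) \<le> degree P"
        using card_mono[OF poly_roots_finite roots] card_poly_roots_bound[of P] by fastforce
      \<comment> \<open>The subtraction is not truncated, since \<open>j < d n\<close>; so the
        degree is strictly below the number of roots.\<close>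
      moreover have "degree P \<le> d n - 1"
        unfolding P_def by (intro degree_sum_le) (auto intro: order_trans[OF degree_monom_le])
      ultimately show False using Suc.prems(2)[of n] j by simp
    qed
    moreover have "coeff P j = b j" using j by (simp add: P_def coeff_sum)
    ultimately show "(\<Sum>e\<in>?E. a (e(n := j)) * (\<Prod>k<n. y k ^ e k)) = 0"
      by (simp add: b_def)
  qed (use Suc.prems(1,2) in auto)
  show ?case
  proof
    fix e assume e: "e \<in> PiE {..<Suc n} (\<lambda>k. {..<d k})"
    have less: "e k < d k" if "k < Suc n" for k
      using PiE_mem[OF e, of k] that by simp
    have "restrict e {..<n} \<in> ?E"
      by (rule restrict_PiE_iff[THEN iffD2]) (simp add: less)
    then have "a ((restrict e {..<n})(n := e n)) = 0"
      using step less by blast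
    moreover have "(restrict e {..<n})(n := e n) = e"
      using PiE_arb[OF e] by (intro ext) (simp add: restrict_def)
    ultimately show "a e = 0" by simp
  qed
qed

section \<open>The set \<open>Psi\<close> and the ring of invariants\<close>

lemma Psi_eq_image: "Psi q I = monomial (sum_list I) ` exponents q I"
proof -
  have "monomial (sum_list I) e \<in> monomial (sum_list I) ` exponents q I"
    if "\<forall>k<sum_list I. e k < q ^ tau I k" for e
    using that by (intro image_eqI[of _ _ "restrict e {..<sum_list I}"] monomial_eqI) auto
  then show ?thesis by (auto simp: Psi_def)
qed

lemma inj_on_monomial:
  "inj_on (monomial n :: _ \<Rightarrow> 'a::comm_ring_1 mpoly) (PiE {..<n} D)"
  by (rule inj_onI, rule PiE_ext) (auto simp: monomial_eq_iff)

lemma finite_Psi: "finite (Psi q I)"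
  unfolding Psi_eq_image by (intro finite_imageI finite_PiE) auto

lemma Psi_subset: "Psi q I \<subseteq> carrier (poly_ring (sum_list I))"
  by (auto simp: Psi_def poly_ring_monomial)

lemma one_mem_Psi: "0 < q \<Longrightarrow> 1 \<in> Psi q I"
  by (auto simp: Psi_def monomial_def intro!: exI[of _ "\<lambda>_. 0"])

lemma mem_invariant_ring:
  "p \<in> carrier (invariant_ring n G) \<longleftrightarrow> p \<in> carrier (poly_ring n) \<and> (\<forall>g\<in>G. act g p = p)"
  by (simp add: invariant_ring_def)

lemma invariant_ring_simps [simp]:
  "monoid.mult (invariant_ring n G) = (*)" "one (invariant_ring n G) = 1"
  "zero (invariant_ring n G) = 0" "add (invariant_ring n G) = (+)"
  by (simp_all add: invariant_ring_def)

lemma invariant_ring_add: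
  "p \<in> carrier (invariant_ring n G) \<Longrightarrow> r \<in> carrier (invariant_ring n G) \<Longrightarrow>
    p + r \<in> carrier (invariant_ring n G)"
  by (simp add: mem_invariant_ring poly_ring_add act_add)

lemma invariant_ring_mult:
  "p \<in> carrier (invariant_ring n G) \<Longrightarrow> r \<in> carrier (invariant_ring n G) \<Longrightarrow>
    p * r \<in> carrier (invariant_ring n G)"
  by (simp add: mem_invariant_ring poly_ring_mult act_def subst_mult)

lemma invariant_ring_Const: "Const c \<in> carrier (invariant_ring n G)"
  by (simp add: mem_invariant_ring poly_ring_Const act_def)

lemma invariant_ring_0: "0 \<in> carrier (invariant_ring n G)"
  using invariant_ring_Const[of 0] by simp

lemma invariant_ring_1: "1 \<in> carrier (invariant_ring n G)"
  using invariant_ring_Const[of 1] by simp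

lemma invariant_ring_uminus:
  "p \<in> carrier (invariant_ring n G) \<Longrightarrow> - p \<in> carrier (invariant_ring n G)"
  by (simp add: mem_invariant_ring poly_ring_uminus act_def subst_uminus)

lemma invariant_ring_diff:
  "p \<in> carrier (invariant_ring n G) \<Longrightarrow> r \<in> carrier (invariant_ring n G) \<Longrightarrow>
    p - r \<in> carrier (invariant_ring n G)"
  using invariant_ring_add[of p n G "- r"] by (simp add: invariant_ring_uminus)

lemma invariant_ring_sum:
  "(\<And>i. i \<in> A \<Longrightarrow> p i \<in> carrier (invariant_ring n G)) \<Longrightarrow>
    (\<Sum>i\<in>A. p i) \<in> carrier (invariant_ring n G)"
  by (induction A rule: infinite_finite_induct) (auto intro: invariant_ring_0 invariant_ring_add)

lemma cring_invariant_ring: "cring (invariant_ring n G)"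
proof (intro cringI abelian_groupI comm_monoidI)
  fix p :: "'a mpoly" assume "p \<in> carrier (invariant_ring n G)"
  then show "\<exists>r\<in>carrier (invariant_ring n G). r \<oplus>\<^bsub>invariant_ring n G\<^esub> p = \<zero>\<^bsub>invariant_ring n G\<^esub>"
    by (intro bexI[of _ "- p"]) (auto intro: invariant_ring_uminus)
qed (auto intro: invariant_ring_0 invariant_ring_1 invariant_ring_add invariant_ring_mult
    simp: algebra_simps)

lemma orbit_prod_invariant:
  "k < sum_list I \<Longrightarrow> (orbit_prod I k :: 'a::{field,finite} mpoly) \<in>
    carrier (invariant_ring (sum_list I) (block_unitriangular I))"
  by (simp add: mem_invariant_ring poly_ring_orbit_prod act_orbit_prod)

text \<open>The combinations with invariant coefficients form a closed set for the division
  argument, because constants and orbit products are themselves invariant.\<close>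

lemma Psi_spans:
  fixes p :: "'a::{field,finite} mpoly"
  assumes "p \<in> carrier (poly_ring (sum_list I))"
  shows "\<exists>a. (\<forall>b. a b \<in> carrier (invariant_ring (sum_list I) (block_unitriangular I))) \<and>
    p = (\<Sum>b\<in>Psi CARD('a) I. a b * b)"
proof -
  let ?R = "carrier (invariant_ring (sum_list I) (block_unitriangular I)) :: 'a mpoly set"
  let ?B = "Psi CARD('a) I :: 'a mpoly set"
  define M where "M = {\<Sum>b\<in>?B. a b * b | a. \<forall>b. a b \<in> ?R}"
  have M_I: "p \<in> M" if "\<forall>b. a b \<in> ?R" "p = (\<Sum>b\<in>?B. a b * b)" for a p
    unfolding M_def using that by (intro CollectI exI[of _ a]) simp
  have mult: "r * p \<in> M" if r: "r \<in> ?R" and p: "p \<in> M" for r p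
  proof -
    obtain a where "\<forall>b. a b \<in> ?R" "p = (\<Sum>b\<in>?B. a b * b)" using p by (auto simp: M_def)
    then have "\<forall>b. r * a b \<in> ?R" "r * p = (\<Sum>b\<in>?B. (r * a b) * b)"
      using r by (auto simp: invariant_ring_mult sum_distrib_left mult.assoc)
    then show ?thesis by (rule M_I)
  qed
  have "carrier (poly_ring (sum_list I)) \<subseteq> M"
  proof (rule poly_ring_subset_if_closed)
    fix p r assume "p \<in> M" "r \<in> M"
    then obtain a b where "\<forall>c. a c \<in> ?R" "p = (\<Sum>c\<in>?B. a c * c)"
      "\<forall>c. b c \<in> ?R" "r = (\<Sum>c\<in>?B. b c * c)" by (auto simp: M_def)
    then have "\<forall>c. a c + b c \<in> ?R" "p + r = (\<Sum>c\<in>?B. (a c + b c) * c)"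
      by (auto simp: invariant_ring_add sum.distrib distrib_right)
    then show "p + r \<in> M" by (rule M_I)
  next
    show "?B \<subseteq> M"
    proof
      fix b assume b: "b \<in> ?B"
      let ?a = "\<lambda>c. if c = b then 1 else 0 :: 'a mpoly"
      have "(\<Sum>c\<in>?B. ?a c * c) = (\<Sum>c\<in>?B. if c = b then c else 0)"
        by (intro sum.cong) auto
      then have "(\<Sum>c\<in>?B. ?a c * c) = b" using b by (simp add: finite_Psi)
      then show "b \<in> M"
        by (intro M_I[of ?a]) (simp_all add: invariant_ring_0 invariant_ring_1)
    qed
  qed (auto intro: mult invariant_ring_Const orbit_prod_invariant)
  then have "p \<in> M" using assms by blast
  then show ?thesis by (auto simp: M_def)
qed

text \<open>A group element fixes the coefficients and moves the variables to any chosen grid point.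
  The grid lemma is used with the polynomial ring itself as the integral domain.\<close>

lemma Psi_independent:
  fixes a :: "'a::{field,finite} mpoly \<Rightarrow> 'a mpoly"
  assumes inv: "\<And>b. b \<in> Psi CARD('a) I \<Longrightarrow>
      a b \<in> carrier (invariant_ring (sum_list I) (block_unitriangular I))"
    and rel: "(\<Sum>b\<in>Psi CARD('a) I. a b * b) = 0" and b: "b \<in> Psi CARD('a) I"
  shows "a b = 0"
proof -
  let ?N = "sum_list I"
  let ?E = "exponents CARD('a) I"
  let ?mon = "monomial ?N :: _ \<Rightarrow> 'a mpoly"
  have inv': "act g (a (?mon e)) = a (?mon e)"
    if "e \<in> ?E" "g \<in> block_unitriangular I" for e g
    using inv[of "?mon e"] that by (auto simp: Psi_eq_image mem_invariant_ring)
  have rel': "(\<Sum>e\<in>?E. a (?mon e) * ?mon e) = 0"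
    using rel by (simp add: Psi_eq_image sum.reindex[OF inj_on_monomial])
  have "\<forall>e\<in>?E. a (?mon e) = 0"
  proof (rule vanishing_on_grid)
    fix y :: "nat \<Rightarrow> 'a mpoly" assume "\<And>k. k < ?N \<Longrightarrow> y k \<in> root_set I k"
    then obtain g where g: "g \<in> block_unitriangular I"
      and y: "\<And>k. k < ?N \<Longrightarrow> act g (Var k) = y k"
      using exists_block_unitriangular by blast
    have "act g (?mon e) = (\<Prod>k<?N. y k ^ e k)" for e
      using y by (simp add: monomial_def act_def subst_prod subst_power)
    then have "(\<Sum>e\<in>?E. a (?mon e) * (\<Prod>k<?N. y k ^ e k)) =
        (\<Sum>e\<in>?E. act g (a (?mon e)) * act g (?mon e))"
      using inv' g by (intro sum.cong) auto
    also have "\<dots> = act g (\<Sum>e\<in>?E. a (?mon e) * ?mon e)"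
      by (simp add: act_def subst_sum subst_mult)
    finally show "(\<Sum>e\<in>?E. a (?mon e) * (\<Prod>k<?N. y k ^ e k)) = 0"
      by (simp add: rel' act_def)
  qed (simp_all add: finite_root_set card_root_set)
  then show ?thesis using b by (auto simp: Psi_eq_image)
qed


section \<open>Module bases and the Hilbert ideal\<close>

lemma scalars_via_simps [simp]:
  "carrier (scalars_via h S) = carrier S" "monoid.mult (scalars_via h S) = monoid.mult S"
  "one (scalars_via h S) = one S" "zero (scalars_via h S) = zero S"
  "add (scalars_via h S) = add S" "a \<odot>\<^bsub>scalars_via h S\<^esub> x = h a \<otimes>\<^bsub>S\<^esub> x"
  by (simp_all add: scalars_via_def)

lemma module_scalars_via:
  assumes R: "cring R" and S: "ring S" and h: "h \<in> Ring.ring_hom R S"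
  shows "Module.module R (scalars_via h S)"
proof -
  interpret R: cring R by (rule R)
  interpret S: ring S by (rule S)
  show ?thesis
  proof (intro moduleI R abelian_groupI)
    fix x assume "x \<in> carrier (scalars_via h S)"
    then show "\<exists>y\<in>carrier (scalars_via h S). y \<oplus>\<^bsub>scalars_via h S\<^esub> x = \<zero>\<^bsub>scalars_via h S\<^esub>"
      using S.l_neg by auto
  qed (use ring_hom_closed[OF h] ring_hom_add[OF h] ring_hom_mult[OF h] ring_hom_one[OF h] in
    \<open>auto simp: S.l_distr S.r_distr S.m_assoc S.a_ac\<close>)
qed

text \<open>For a finite set, span and linear dependence can be tested on combinations indexed by
  the whole set.\<close>

lemma module_basisI:
  assumes M: "Module.module R M" and B: "finite B" "B \<subseteq> carrier M"
    and span: "\<And>x. x \<in> carrier M \<Longrightarrow>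
      \<exists>a\<in>B \<rightarrow> carrier R. x = finsum M (\<lambda>b. a b \<odot>\<^bsub>M\<^esub> b) B"
    and indep: "\<And>a b. a \<in> B \<rightarrow> carrier R \<Longrightarrow>
      finsum M (\<lambda>b. a b \<odot>\<^bsub>M\<^esub> b) B = \<zero>\<^bsub>M\<^esub> \<Longrightarrow> b \<in> B \<Longrightarrow> a b = \<zero>\<^bsub>R\<^esub>"
  shows "module_basis R M B"
proof -
  interpret Module.module R M by (rule M)
  have "span B = carrier M"
    unfolding finite_span[OF B] using span lincomb_closed[OF B(2)] by (force simp: lincomb_def)
  moreover have "\<not> lin_dep B"
    by (rule finite_lin_indpt2[OF B]) (use indep in \<open>auto simp: lincomb_def\<close>)
  ultimately show ?thesis using M B by (simp add: module_basis_def)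
qed

text \<open>Bridges sums in a carrier-based structure and ordinary sums of polynomials. It is used
  for the identity map and for the projection to the coinvariants.\<close>

lemma finsum_hom:
  assumes M: "abelian_monoid M"
    and closed: "\<And>p. p \<in> carrier (poly_ring n) \<Longrightarrow> h p \<in> carrier M"
    and zero: "h 0 = \<zero>\<^bsub>M\<^esub>"
    and add: "\<And>p q. p \<in> carrier (poly_ring n) \<Longrightarrow> q \<in> carrier (poly_ring n) \<Longrightarrow>
      h (p + q) = h p \<oplus>\<^bsub>M\<^esub> h q"
    and "finite A" "\<And>x. x \<in> A \<Longrightarrow> f x \<in> carrier (poly_ring n)"
  shows "finsum M (\<lambda>x. h (f x)) A = h (sum f A)"
proof -
  interpret abelian_monoid M by (rule M)
  show ?thesis using assms(5,6)
  proof (induction A rule: finite_induct)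
    case (insert x A)
    then have "finsum M (\<lambda>x. h (f x)) (insert x A) = h (f x) \<oplus>\<^bsub>M\<^esub> finsum M (\<lambda>x. h (f x)) A"
      using closed by (intro finsum_insert) auto
    then show ?case using insert by (simp add: add poly_ring_sum)
  qed (simp add: zero)
qed

lemma module_basis_Psi:
  fixes I :: "nat list"
  defines "U \<equiv> block_unitriangular I :: 'a::{field,finite} mat set"
  shows "module_basis (invariant_ring (sum_list I) U)
    (scalars_via id (poly_ring (sum_list I))) (Psi CARD('a) I)"
proof -
  let ?P = "poly_ring (sum_list I) :: 'a mpoly ring"
  let ?R = "invariant_ring (sum_list I) U"
  let ?M = "scalars_via id ?P :: ('a mpoly, 'a mpoly) module"
  let ?B = "Psi CARD('a) I :: 'a mpoly set"
  have BP: "?B \<subseteq> carrier ?P" by (rule Psi_subset)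
  have sub: "carrier ?R \<subseteq> carrier ?P" by (auto simp: mem_invariant_ring)
  then have "id \<in> Ring.ring_hom ?R ?P" by (intro ring_hom_memI) auto
  then have M: "Module.module ?R ?M"
    by (intro module_scalars_via cring_invariant_ring cring.axioms(1) cring_poly_ring)
  interpret M: Module.module ?R ?M by (rule M)
  have finsum: "finsum ?M (\<lambda>b. a b \<odot>\<^bsub>?M\<^esub> b) ?B = (\<Sum>b\<in>?B. a b * b)"
    if "a \<in> ?B \<rightarrow> carrier ?R" for a
    using finsum_hom[OF M.M.abelian_monoid_axioms, of "sum_list I" id ?B "\<lambda>b. a b * b"]
      that BP sub by (simp add: finite_Psi Pi_iff subset_iff poly_ring_mult)
  show ?thesis
  proof (rule module_basisI[OF M])
    fix p assume "p \<in> carrier ?M"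
    then obtain a where "\<forall>b. a b \<in> carrier ?R" "p = (\<Sum>b\<in>?B. a b * b)"
      using Psi_spans[of p I] by (auto simp: U_def)
    then show "\<exists>a\<in>?B \<rightarrow> carrier ?R. p = finsum ?M (\<lambda>b. a b \<odot>\<^bsub>?M\<^esub> b) ?B"
      using finsum[of a] by (intro bexI[of _ a]) auto
  next
    fix a b
    assume a: "a \<in> ?B \<rightarrow> carrier ?R"
      and rel: "finsum ?M (\<lambda>b. a b \<odot>\<^bsub>?M\<^esub> b) ?B = \<zero>\<^bsub>?M\<^esub>" and b: "b \<in> ?B"
    have "(\<Sum>b\<in>?B. a b * b) = 0" using rel by (simp only: finsum[OF a]) simp
    then show "a b = \<zero>\<^bsub>?R\<^esub>"
      using Psi_independent[of I a b] a b by (auto simp: U_def)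
  qed (use Psi_subset finite_Psi in auto)
qed

section \<open>Monomial factors of the top monomial\<close>

lemma keys_monomial: "Poly_Mapping.keys (monomial n e :: 'a::comm_ring_1 mpoly) = {expo n e}"
  by (simp add: monomial_eq_single)

text \<open>The cofactor is a priori any polynomial, but one of its terms must supply the missing
  exponents, so divisibility bounds each exponent by \<open>q ^ tau I k - 1\<close>. Positivity of
  \<open>q\<close> turns this into a strict bound by \<open>q ^ tau I k\<close>.\<close>

lemma monomial_factors_f_top:
  assumes "0 < q"
  shows "monomial_factors (sum_list I) (f_top q I) = (Psi q I :: 'a::comm_ring_1 mpoly set)"
proof (intro equalityI subsetI)
  let ?N = "sum_list I"
  fix t :: "'a mpoly" assume "t \<in> monomial_factors ?N (f_top q I)"
  then have "\<exists>e. t = monomial ?N e" "\<exists>c. f_top q I = t * c"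
    by (auto simp: monomial_factors_def factor_def)
  then obtain e c where t: "t = monomial ?N e" and "f_top q I = t * c"
    by blast
  then have f: "f_top q I = monomial ?N e * c" by simp
  have "expo ?N (\<lambda>k. q ^ tau I k - 1) \<in> Poly_Mapping.keys (monomial ?N e * c)"
    by (simp add: f[symmetric] f_top_def keys_monomial)
  then obtain d where d: "expo ?N (\<lambda>k. q ^ tau I k - 1) = expo ?N e + d"
    using keys_mult[of "monomial ?N e" c] by (auto simp: keys_monomial)
  have "e k < q ^ tau I k" if "k < ?N" for k
  proof -
    have "q ^ tau I k - 1 = e k + Poly_Mapping.lookup d k"
      using arg_cong[OF d, of "\<lambda>m. Poly_Mapping.lookup m k"] that
      by (simp add: lookup_add lookup_expo)
    moreover have "0 < q ^ tau I k" using assms by simp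
    ultimately show ?thesis by linarith
  qed
  then show "t \<in> Psi q I" by (auto simp: t Psi_def)
next
  let ?N = "sum_list I"
  fix t :: "'a mpoly" assume "t \<in> Psi q I"
  then obtain e where t: "t = monomial ?N e" and e: "\<forall>k<?N. e k < q ^ tau I k"
    by (auto simp: Psi_def)
  have "f_top q I = t * monomial ?N (\<lambda>k. q ^ tau I k - 1 - e k)"
    unfolding t f_top_def monomial_mult using e by (intro monomial_eqI) force
  then show "t \<in> monomial_factors ?N (f_top q I)"
    by (auto simp: monomial_factors_def factor_def t poly_ring_monomial)
qed

lemma lookup_mult_0_eq_0:
  fixes p r :: "'a::comm_ring_1 mpoly"
  assumes "Poly_Mapping.lookup p 0 = 0"
  shows "Poly_Mapping.lookup (p * r) 0 = 0"
proof (rule ccontr)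
  assume "Poly_Mapping.lookup (p * r) 0 \<noteq> 0"
  then obtain a b where ab: "0 = a + b" "a \<in> Poly_Mapping.keys p"
    using keys_mult[of p r] by (auto simp: in_keys_iff)
  have "a = 0"
    using arg_cong[OF ab(1), of Poly_Mapping.lookup] by (intro poly_mapping_eqI) (simp add: lookup_add fun_eq_iff)
  then show False using ab assms by (simp add: in_keys_iff)
qed

section \<open>The Hilbert ideal and the coinvariants\<close>

context
  fixes I :: "nat list" and N q :: nat and U :: "'a::{field,finite} mat set"
    and P :: "'a mpoly ring" and R and H and B :: "'a mpoly set"
  defines "N \<equiv> sum_list I" and "q \<equiv> CARD('a)" and "U \<equiv> block_unitriangular I"
    and "P \<equiv> poly_ring N" and "R \<equiv> carrier (invariant_ring N U)" and "H \<equiv> hilbert_ideal N U"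
    and "B \<equiv> Psi q I"
begin

lemma finite_B: "finite B"
  unfolding B_def by (rule finite_Psi)

lemma B_subset: "B \<subseteq> carrier P"
  unfolding B_def P_def N_def by (rule Psi_subset)

interpretation P: cring P
  unfolding P_def by (rule cring_poly_ring)

lemma ideal_hilbert: "ideal H P"
  unfolding H_def hilbert_ideal_def P_def[symmetric]
  by (rule P.genideal_ideal) (auto simp: mem_invariant_ring P_def)

interpretation H: ideal H P by (rule ideal_hilbert)

text \<open>The degree is positive even in the first block, where \<open>tau I k = 0\<close> and the
  orbit product is \<open>Var k\<close> itself.\<close>

lemma orbit_prod_mem_hilbert:
  assumes "k < N"
  shows "orbit_prod I k \<in> H"
proof -
  have "homogeneous (q ^ tau I k) (orbit_prod I k :: 'a mpoly)"
    using assms unfolding q_def N_def by (rule homogeneous_orbit_prod)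
  moreover have "0 < q ^ tau I k" by (simp add: q_def)
  moreover have "(orbit_prod I k :: 'a mpoly) \<in> R"
    using assms unfolding R_def N_def U_def by (rule orbit_prod_invariant)
  ultimately have "orbit_prod I k \<in> {p \<in> carrier (invariant_ring N U). \<exists>d>0. homogeneous d p}"
    unfolding R_def by blast
  then show ?thesis
    unfolding H_def hilbert_ideal_def genideal_def by blast
qed

lemma hilbert_add: "x \<in> H \<Longrightarrow> y \<in> H \<Longrightarrow> x + y \<in> H"
  using H.a_closed by (simp add: P_def)

lemma hilbert_mult: "x \<in> H \<Longrightarrow> y \<in> carrier P \<Longrightarrow> x * y \<in> H"
  using H.I_r_closed by (simp add: P_def)

lemma hilbert_0: "0 \<in> H"
  using H.zero_closed by (simp add: P_def)

lemma Psi_spans_mod_hilbert: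
  assumes "p \<in> carrier P"
  shows "\<exists>c. p - (\<Sum>b\<in>B. Const (c b) * b) \<in> H"
proof -
  define M where "M = {p \<in> carrier P. \<exists>c. p - (\<Sum>b\<in>B. Const (c b) * b) \<in> H}"
  have M_I: "p \<in> M" if "p \<in> carrier P" "p - (\<Sum>b\<in>B. Const (c b) * b) \<in> H" for p c
    using that by (auto simp: M_def)
  have "carrier (poly_ring (sum_list I)) \<subseteq> M"
  proof (rule poly_ring_subset_if_closed)
    fix p r assume "p \<in> M" "r \<in> M"
    then obtain c d where cd: "p - (\<Sum>b\<in>B. Const (c b) * b) \<in> H" "r - (\<Sum>b\<in>B. Const (d b) * b) \<in> H"
      and P: "p \<in> carrier P" "r \<in> carrier P" by (auto simp: M_def)
    have "p + r - (\<Sum>b\<in>B. Const (c b + d b) * b) =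
        (p - (\<Sum>b\<in>B. Const (c b) * b)) + (r - (\<Sum>b\<in>B. Const (d b) * b))"
      by (simp add: Const_add distrib_right sum.distrib)
    then have "p + r - (\<Sum>b\<in>B. Const (c b + d b) * b) \<in> H"
      using hilbert_add[OF cd] by (simp only:)
    then show "p + r \<in> M"
      by (rule M_I[rotated]) (use P in \<open>simp add: P_def poly_ring_add\<close>)
  next
    fix a p assume "p \<in> M"
    then obtain c where c: "p - (\<Sum>b\<in>B. Const (c b) * b) \<in> H" and P: "p \<in> carrier P"
      by (auto simp: M_def)
    have "Const a * p - (\<Sum>b\<in>B. Const (a * c b) * b) = (p - (\<Sum>b\<in>B. Const (c b) * b)) * Const a"
      by (simp add: Const_mult left_diff_distrib sum_distrib_right mult_ac right_diff_distrib sum_distrib_left)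
    then have "Const a * p - (\<Sum>b\<in>B. Const (a * c b) * b) \<in> H"
      using hilbert_mult[OF c, of "Const a"] by (simp add: P_def poly_ring_Const)
    then show "Const a * p \<in> M"
      by (rule M_I[rotated]) (use P in \<open>simp add: P_def poly_ring_mult poly_ring_Const\<close>)
  next
    fix k p assume "k < sum_list I" "p \<in> M"
    then show "orbit_prod I k * p \<in> M"
      \<comment> \<open>The product already lies in \<open>H\<close>, so the zero coefficients
        witness membership in \<open>M\<close>.\<close>
      using hilbert_mult[OF orbit_prod_mem_hilbert[of k], of p]
      by (intro M_I[of _ "\<lambda>_. 0"])
        (auto simp: P_def N_def M_def poly_ring_mult poly_ring_orbit_prod)
  next
    show "Psi CARD('a) I \<subseteq> M"
    proof
      fix b :: "'a mpoly" assume b: "b \<in> Psi CARD('a) I"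
      have "(\<Sum>c\<in>B. Const (if c = b then 1 else 0) * c) = (\<Sum>c\<in>B. if c = b then c else 0)"
        by (intro sum.cong) auto
      then have "(\<Sum>c\<in>B. Const (if c = b then 1 else 0) * c) = b"
        using b finite_B by (simp add: B_def q_def)
      then show "b \<in> M"
        using b B_subset hilbert_0
        by (intro M_I[of _ "\<lambda>c. if c = b then 1 else 0"]) (auto simp: B_def q_def)
    qed
  qed
  then show ?thesis using assms by (auto simp: P_def N_def M_def)
qed

text \<open>The combinations whose invariant coefficients have zero constant term form an ideal
  containing all generators of \<open>H\<close>.\<close>

lemma hilbert_subset:
  assumes "p \<in> H"
  shows "\<exists>a. (\<forall>b. a b \<in> R \<and> Poly_Mapping.lookup (a b) 0 = 0) \<and> p = (\<Sum>b\<in>B. a b * b)"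
proof -
  define J where "J = {\<Sum>b\<in>B. a b * b | a. \<forall>b. a b \<in> R \<and> Poly_Mapping.lookup (a b) 0 = 0}"
  have J_I: "p \<in> J" if "\<And>b. a b \<in> R" "\<And>b. Poly_Mapping.lookup (a b) 0 = 0"
    "p = (\<Sum>b\<in>B. a b * b)" for a p
    unfolding J_def using that by (intro CollectI exI[of _ a]) simp
  have J_P: "p \<in> carrier P" if "p \<in> J" for p
    using that B_subset
    by (auto simp: J_def P_def R_def mem_invariant_ring intro!: poly_ring_sum poly_ring_mult)
  have J_add: "p + r \<in> J" if "p \<in> J" "r \<in> J" for p r
  proof -
    obtain a c where "\<forall>b. a b \<in> R \<and> Poly_Mapping.lookup (a b) 0 = 0" "p = (\<Sum>b\<in>B. a b * b)"
      "\<forall>b. c b \<in> R \<and> Poly_Mapping.lookup (c b) 0 = 0" "r = (\<Sum>b\<in>B. c b * b)"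
      using \<open>p \<in> J\<close> \<open>r \<in> J\<close> by (auto simp: J_def)
    then show ?thesis
      by (intro J_I[of "\<lambda>b. a b + c b"])
        (auto simp: R_def invariant_ring_add lookup_add sum.distrib distrib_right)
  qed
  have J_mult: "p * x \<in> J" if p: "p \<in> J" and x: "x \<in> carrier P" for p x
  proof -
    obtain a where a: "\<forall>b. a b \<in> R \<and> Poly_Mapping.lookup (a b) 0 = 0" and p: "p = (\<Sum>b\<in>B. a b * b)"
      using p by (auto simp: J_def)
    \<comment> \<open>Each \<open>b * x\<close> is re-expanded in \<open>Psi\<close> with invariant
      coefficients; multiplying these by \<open>a b\<close> preserves the zero constant
      term.\<close>
    have "\<forall>b\<in>B. \<exists>t. (\<forall>c. t c \<in> R) \<and> b * x = (\<Sum>c\<in>B. t c * c)"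
    proof
      fix b assume "b \<in> B"
      then have "b * x \<in> carrier (poly_ring (sum_list I))"
        using x B_subset by (auto simp: P_def N_def intro: poly_ring_mult)
      then show "\<exists>t. (\<forall>c. t c \<in> R) \<and> b * x = (\<Sum>c\<in>B. t c * c)"
        using Psi_spans by (simp add: R_def B_def q_def U_def N_def)
    qed
    then obtain t where t: "\<And>b c. b \<in> B \<Longrightarrow> t b c \<in> R" "\<And>b. b \<in> B \<Longrightarrow> b * x = (\<Sum>c\<in>B. t b c * c)"
      by metis
    have "p * x = (\<Sum>b\<in>B. a b * (\<Sum>c\<in>B. t b c * c))"
      by (simp add: p sum_distrib_right mult.assoc t(2))
    also have "\<dots> = (\<Sum>c\<in>B. (\<Sum>b\<in>B. a b * t b c) * c)"
      unfolding sum_distrib_left sum_distrib_right by (subst sum.swap) (simp add: mult.assoc)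
    finally show ?thesis
      using a t(1) by (intro J_I[of "\<lambda>c. \<Sum>b\<in>B. a b * t b c"])
        (auto simp: R_def lookup_sum lookup_mult_0_eq_0 intro!: invariant_ring_sum invariant_ring_mult)
  qed
  have J_0: "0 \<in> J"
    by (intro J_I[of "\<lambda>_. 0"]) (auto simp: R_def invariant_ring_0)
  have "ideal J P"
  proof (rule idealI)
    show "ring P" by (rule P.ring_axioms)
    show "subgroup J (add_monoid P)"
    proof (rule P.add.subgroupI)
      fix p assume p: "p \<in> J"
      have "- p \<in> J" using J_mult[OF p, of "- 1"]
        by (simp add: P_def poly_ring_uminus poly_ring_1)
      moreover have "\<ominus>\<^bsub>P\<^esub> p = - p"
        using J_P[OF p] by (intro P.minus_equality) (auto simp: P_def poly_ring_uminus)
      ultimately show "\<ominus>\<^bsub>P\<^esub> p \<in> J" by simp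
    qed (use J_P J_add J_0 in \<open>auto simp: P_def\<close>)
    fix p x assume "p \<in> J" "x \<in> carrier P"
    then show "x \<otimes>\<^bsub>P\<^esub> p \<in> J" "p \<otimes>\<^bsub>P\<^esub> x \<in> J"
      using J_mult[of p x] by (auto simp: P_def mult.commute)
  qed
  \<comment> \<open>A generator \<open>p\<close> is \<open>p * 1\<close> with \<open>1\<close> in
    \<open>Psi\<close>, and positive degree removes its constant term.\<close>
  moreover have "{p \<in> carrier (invariant_ring N U). \<exists>d>0. homogeneous d p} \<subseteq> J"
  proof clarify
    fix p :: "'a mpoly" and d :: nat
    assume p: "p \<in> carrier (invariant_ring N U)" and d: "0 < d" "homogeneous d p"
    have l: "Poly_Mapping.lookup p 0 = 0"
      using d by (force simp: homogeneous_def in_keys_iff)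
    have "(\<Sum>b\<in>B. (if b = 1 then p else 0) * b) = (\<Sum>b\<in>B. if b = 1 then p else 0)"
      by (intro sum.cong) auto
    then have "(\<Sum>b\<in>B. (if b = 1 then p else 0) * b) = p"
      using finite_B by (simp add: B_def q_def one_mem_Psi)
    then show "p \<in> J"
      using p l by (intro J_I[of "\<lambda>b. if b = 1 then p else 0"]) (auto simp: R_def invariant_ring_0)
  qed
  ultimately have "H \<subseteq> J"
    unfolding H_def hilbert_ideal_def P_def[symmetric] by (rule P.genideal_minimal)
  then show ?thesis using assms by (auto simp: J_def)
qed

text \<open>An element of \<open>H\<close> has an expansion whose coefficients lack constant terms.
  Uniqueness over the invariants identifies these with the constants \<open>Const (c b)\<close>,
  which must then be zero.\<close>

lemma Psi_independent_mod_hilbert: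
  assumes "(\<Sum>b\<in>B. Const (c b) * b) \<in> H" and b: "b \<in> B"
  shows "c b = 0"
proof -
  obtain a where a: "\<And>b. a b \<in> R" "\<And>b. Poly_Mapping.lookup (a b) 0 = 0"
    and eq: "(\<Sum>b\<in>B. Const (c b) * b) = (\<Sum>b\<in>B. a b * b)"
    using hilbert_subset[OF assms(1)] by blast
  have "(\<Sum>b\<in>Psi CARD('a) I. (Const (c b) - a b) * b) = 0"
    using eq by (simp add: B_def q_def left_diff_distrib sum_subtractf)
  moreover have "Const (c b) - a b \<in> carrier (invariant_ring (sum_list I) (block_unitriangular I))" for b
    using a(1)[of b] by (auto simp: R_def U_def N_def intro: invariant_ring_diff invariant_ring_Const)
  ultimately have "Const (c b) - a b = 0"
    using b by (intro Psi_independent[of I "\<lambda>b. Const (c b) - a b"]) (auto simp: B_def q_def)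
  then have "Poly_Mapping.lookup (Const (c b)) 0 = 0" using a(2)[of b] by simp
  then show ?thesis by (simp add: Const_def)
qed

lemma proj_eq_iff:
  assumes "p \<in> carrier P" "r \<in> carrier P"
  shows "coinvariant_proj N U p = coinvariant_proj N U r \<longleftrightarrow> p - r \<in> H"
proof -
  have "\<ominus>\<^bsub>P\<^esub> r = - r"
    using assms by (intro P.minus_equality) (auto simp: P_def poly_ring_uminus)
  then have "p \<ominus>\<^bsub>P\<^esub> r = p - r" by (simp add: a_minus_def P_def)
  then show ?thesis
    using P.quotient_eq_iff_same_a_r_cos[OF ideal_hilbert assms]
    by (simp add: coinvariant_proj_def H_def P_def)
qed

text \<open>Spanning and independence are known for polynomial representatives; what remains is to
  carry them over to residue classes.\<close>

lemma generates_block_basis_f_top: "generates_block_basis N U (f_top q I)"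
proof -
  let ?Q = "coinvariant_ring N U"
  let ?p = "coinvariant_proj N U"
  let ?K = "class_ring :: 'a ring"
  let ?M = "scalars_via (\<lambda>c. ?p (Const c)) ?Q"
  note fin = finite_B and BP = B_subset
  have p_eq: "?p = (+>\<^bsub>P\<^esub>) H" by (simp add: fun_eq_iff coinvariant_proj_def H_def P_def)
  have Q_eq: "?Q = P Quot H" by (simp add: coinvariant_ring_def H_def P_def)
  have hom: "?p \<in> Ring.ring_hom P ?Q" unfolding p_eq Q_eq by (rule H.rcos_ring_hom)
  have carrier_Q: "carrier ?Q = ?p ` carrier P"
    unfolding Q_eq p_eq by (auto simp: FactRing_def A_RCOSETS_def')
  have p_0: "?p 0 = \<zero>\<^bsub>?Q\<^esub>"
    using ring_hom_zero[OF hom P.ring_axioms] H.quotient_is_ring by (simp add: P_def Q_eq)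
  have p_add: "?p (x + y) = ?p x \<oplus>\<^bsub>?Q\<^esub> ?p y" if "x \<in> carrier P" "y \<in> carrier P" for x y
    using ring_hom_add[OF hom that] by (simp add: P_def)
  have p_mult: "?p (x * y) = ?p x \<otimes>\<^bsub>?Q\<^esub> ?p y" if "x \<in> carrier P" "y \<in> carrier P" for x y
    using ring_hom_mult[OF hom that] by (simp add: P_def)
  have Const_P: "Const c \<in> carrier P" for c by (simp add: P_def poly_ring_Const)
  have "(\<lambda>c. ?p (Const c)) \<in> Ring.ring_hom ?K ?Q"
    using ring_hom_one[OF hom] p_add p_mult Const_P
    by (intro ring_hom_memI) (auto simp: carrier_Q Const_add Const_mult P_def)
  then have M: "Module.module ?K ?M"
    by (intro module_scalars_via class_cring.cring_axioms) (auto simp: Q_eq H.quotient_is_ring)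
  interpret M: Module.module ?K ?M by (rule M)
  have inj: "inj_on ?p B"
  proof (rule inj_onI, rule ccontr)
    fix b b' assume b: "b \<in> B" "b' \<in> B" "?p b = ?p b'" "b \<noteq> b'"
    \<comment> \<open>Two distinct elements of \<open>B\<close> in one class would give a relation
      with coefficients 1 and -1.\<close>
    let ?c = "\<lambda>x. if x = b then 1 else if x = b' then - 1 else 0 :: 'a"
    have "(\<Sum>x\<in>B. Const (?c x) * x) = (\<Sum>x\<in>B. (if x = b then x else 0) - (if x = b' then x else 0))"
      using b(4) by (intro sum.cong) (auto simp: Const_uminus)
    also have "\<dots> = b - b'" using b fin by (simp add: sum_subtractf)
    finally have "(\<Sum>x\<in>B. Const (?c x) * x) \<in> H" using b BP proj_eq_iff[of b b'] by auto
    from Psi_independent_mod_hilbert[OF this b(1)] show False by simp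
  qed
  \<comment> \<open>Coefficients here are indexed by residue classes; injectivity on
    \<open>B\<close> turns the sum into one over representatives.\<close>
  have finsum: "finsum ?M (\<lambda>b. a b \<odot>\<^bsub>?M\<^esub> b) (?p ` B) = ?p (\<Sum>b\<in>B. Const (a (?p b)) * b)" for a
  proof -
    have "finsum ?M (\<lambda>b. a b \<odot>\<^bsub>?M\<^esub> b) (?p ` B) = finsum ?M (\<lambda>b. a (?p b) \<odot>\<^bsub>?M\<^esub> ?p b) B"
      using inj BP by (intro M.M.finsum_reindex) (auto simp: carrier_Q p_mult[OF Const_P, symmetric] P_def
        poly_ring_mult poly_ring_Const subset_iff)
    also have "\<dots> = finsum ?M (\<lambda>b. ?p (Const (a (?p b)) * b)) B"
      using BP by (intro M.M.finsum_cong') (auto simp: carrier_Q p_mult Const_P subset_iff P_def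
        poly_ring_mult poly_ring_Const)
    also have "\<dots> = ?p (\<Sum>b\<in>B. Const (a (?p b)) * b)"
      using BP fin p_0 p_add
      by (intro finsum_hom[OF M.M.abelian_monoid_axioms, where n = N])
        (auto simp: carrier_Q P_def poly_ring_mult poly_ring_Const subset_iff)
    finally show ?thesis .
  qed
  have sum_P: "(\<Sum>b\<in>B. Const (c b) * b) \<in> carrier P" for c
    using BP by (auto simp: P_def intro!: poly_ring_sum poly_ring_mult poly_ring_Const)
  have basis: "module_basis ?K ?M (?p ` B)"
  proof (rule module_basisI[OF M])
    fix x assume "x \<in> carrier ?M"
    then obtain p where p: "p \<in> carrier P" "x = ?p p" by (auto simp: carrier_Q)
    obtain c where c: "p - (\<Sum>b\<in>B. Const (c b) * b) \<in> H"
      using Psi_spans_mod_hilbert[OF p(1)] by blast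
    \<comment> \<open>The coefficient of a class is that of its unique representative in
      \<open>B\<close>.\<close>
    let ?a = "\<lambda>y. c (inv_into B ?p y)"
    have "(\<Sum>b\<in>B. Const (?a (?p b)) * b) = (\<Sum>b\<in>B. Const (c b) * b)"
      using inj by (intro sum.cong) auto
    then have "x = finsum ?M (\<lambda>b. ?a b \<odot>\<^bsub>?M\<^esub> b) (?p ` B)"
      unfolding finsum p(2) using proj_eq_iff[OF p(1) sum_P] c by simp
    then show "\<exists>a\<in>?p ` B \<rightarrow> carrier ?K. x = finsum ?M (\<lambda>b. a b \<odot>\<^bsub>?M\<^esub> b) (?p ` B)"
      by (intro bexI[of _ ?a]) auto
  next
    fix a y
    assume rel: "finsum ?M (\<lambda>b. a b \<odot>\<^bsub>?M\<^esub> b) (?p ` B) = \<zero>\<^bsub>?M\<^esub>" and y: "y \<in> ?p ` B"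
    obtain b where b: "b \<in> B" "y = ?p b" using y by blast
    have "?p (\<Sum>b\<in>B. Const (a (?p b)) * b) = ?p 0"
      using rel unfolding finsum p_0 by simp
    then have "(\<Sum>b\<in>B. Const (a (?p b)) * b) \<in> H"
      using proj_eq_iff[OF sum_P, of 0] by (simp add: P_def poly_ring_0)
    from Psi_independent_mod_hilbert[OF this b(1)] show "a y = \<zero>\<^bsub>?K\<^esub>" by (simp add: b)
  qed (use fin BP in \<open>auto simp: carrier_Q\<close>)
  have "monomial_factors N (f_top q I) = B"
    unfolding N_def B_def by (rule monomial_factors_f_top) (simp add: q_def)
  moreover have "\<exists>e. f_top q I = monomial N e" by (auto simp: f_top_def N_def)
  ultimately show ?thesis
    using inj basis by (simp add: generates_block_basis_def)
qed

end

theorem theorem5p2: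
  fixes I :: "nat list" and n q :: nat and U :: "'a::{field,finite} mat set"
  assumes "q = CARD('a)"
    and "composition I n"
    and "U = block_unitriangular I"
  shows "module_basis (invariant_ring n U) (scalars_via id (poly_ring n)) (Psi q I)
    \<and> generates_block_basis n U (f_top q I)"
proof -
  have "n = sum_list I" using assms(2) by (simp add: composition_def)
  then show ?thesis
    using module_basis_Psi[of I] generates_block_basis_f_top[of I] assms(1,3) by simp
qed

end
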